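(* Let $u_0\in L^1(M)$. Then there exists a unique solution $u\in C([0,\infty);L^1(M))$ of the Cauchy problem $$u_t-Lu=0\ \text{ in } M\times(0,\infty),\qquad u(x,0)=u_0(x)\ \text{ in } M,$$ and it satisfies $\|u(\cdot,t)\|_{L^1(M)}\le\|u_0\|_{L^1(M)}$ for all $t\ge 0$. If moreover $u_0\in L^1(M)\cap L^\infty(M)$, then $\|u(\cdot,t)\|_{L^\infty(M)}\le\|u_0\|_{L^\infty(M)}$ for all $t\ge0$.
   Context: $M$ is an $N$-dimensional Riemannian manifold without boundary, $O\in M$ is a fixed point, and there is a family of isometries $\tau_x:M\to M$, $x\in M$, with $\tau_x(x)=O$. $\mu$ is a measure on $M$ invariant under all the isometries $\tau_x$, and $L^p(M)=L^p(M,\mu)$. $s_{xy}$ denotes the geodesic distance between $x,y\in M$. $J:\mathbb{R}_{\ge0}\to\mathbb{R}_{\ge0}$ is a function normalized by $\int_M J(s_{xO})\,d\mu_x=1$. The operator $L$ is $$Lu(x)=\int_M J(s_{xy})u(y)\,d\mu_y-u(x).$$ Being a solution of the Cauchy problem is equivalent to satisfying, for all $t\geq 0$, $$u(x,t)=e^{-t}u_0(x)+\int_0^t\int_M e^{-(t-r)}J(s_{xy})u(y,r)\,d\mu_y\,dr .$$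
   Formalization: The measure μ is additionally assumed to be a σ-finite Borel measure (for a general invariant measure the claim can fail); M is taken connected so that the geodesic distance is finite, and J is taken Borel measurable. *)

theory Defs
  imports "HOL-Analysis.Analysis" "HOL-Probability.Essential_Supremum"
begin

section \<open>Smooth maps between open subsets of Euclidean spaces\<close>

text \<open>The set \<open>S\<close> is meant to be open. Over a finite-dimensional domain, a map is \<open>C^(k+1)\<close> iff it
  is differentiable and all its directional derivatives are \<open>C^k\<close>.\<close>

primrec Ck_on :: "nat \<Rightarrow> 'a::euclidean_space set \<Rightarrow> ('a \<Rightarrow> 'b::real_normed_vector) \<Rightarrow> bool" where
  "Ck_on 0 S f \<longleftrightarrow> continuous_on S f"
| "Ck_on (Suc k) S f \<longleftrightarrow>
     (\<forall>x\<in>S. f differentiable (at x)) \<and>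
     (\<forall>v. Ck_on k S (\<lambda>x. frechet_derivative f (at x) v))"

definition smooth_on :: "'a::euclidean_space set \<Rightarrow> ('a \<Rightarrow> 'b::real_normed_vector) \<Rightarrow> bool" where
  "smooth_on S f \<longleftrightarrow> (\<forall>k. Ck_on k S f)"


section \<open>Riemannian manifolds\<close>

text \<open>The points of the manifold are the elements of a Hausdorff, second countable type \<open>'a\<close>; the
  model space is \<open>'e\<close>, so the dimension is \<open>N = DIM('e)\<close>. A chart is a pair \<open>(U, \<phi>)\<close>; the values
  of \<open>\<phi>\<close> outside \<open>U\<close> are irrelevant. Chart images are open in the whole of \<open>'e\<close>, so there is
  no boundary.\<close>

type_synonym ('a, 'e) chart = "'a set \<times> ('a \<Rightarrow> 'e)"

definition is_chart :: "('a::topological_space, 'e::euclidean_space) chart \<Rightarrow> bool" where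
  "is_chart c \<longleftrightarrow> (case c of (U, \<phi>) \<Rightarrow>
     open U \<and> open (\<phi> ` U) \<and> homeomorphism U (\<phi> ` U) \<phi> (inv_into U \<phi>))"

definition smooth_manifold ::
    "('a::{t2_space,second_countable_topology}, 'e::euclidean_space) chart set \<Rightarrow> bool" where
  "smooth_manifold \<A> \<longleftrightarrow>
     (\<forall>c\<in>\<A>. is_chart c) \<and>
     (\<Union>(U, \<phi>)\<in>\<A>. U) = UNIV \<and>
     (\<forall>(U, \<phi>)\<in>\<A>. \<forall>(V, \<psi>)\<in>\<A>. smooth_on (\<phi> ` (U \<inter> V)) (\<psi> \<circ> inv_into U \<phi>))"

text \<open>A Riemannian metric is given by its local representatives: \<open>g (U, \<phi>) q v w\<close> is the inner
  product of the tangent vectors at \<open>\<phi>\<^sup>-\<^sup>1(q)\<close> with coordinates \<open>v\<close>, \<open>w\<close> in the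
  chart \<open>(U, \<phi>)\<close>, for \<open>q \<in> \<phi>(U)\<close>. The last condition is the transformation law of a covariant
  2-tensor, which makes the inner product independent of the chart.\<close>

type_synonym ('a, 'e) metric_tensor = "('a, 'e) chart \<Rightarrow> 'e \<Rightarrow> 'e \<Rightarrow> 'e \<Rightarrow> real"

definition riemannian_metric ::
    "('a::{t2_space,second_countable_topology}, 'e::euclidean_space) chart set
      \<Rightarrow> ('a, 'e) metric_tensor \<Rightarrow> bool" where
  "riemannian_metric \<A> g \<longleftrightarrow>
     (\<forall>(U, \<phi>)\<in>\<A>. \<forall>q\<in>\<phi> ` U.
        bilinear (g (U, \<phi>) q) \<and>
        (\<forall>v w. g (U, \<phi>) q v w = g (U, \<phi>) q w v) \<and>
        (\<forall>v. v \<noteq> 0 \<longrightarrow> 0 < g (U, \<phi>) q v v)) \<and>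
     (\<forall>(U, \<phi>)\<in>\<A>. \<forall>v w. smooth_on (\<phi> ` U) (\<lambda>q. g (U, \<phi>) q v w)) \<and>
     (\<forall>(U, \<phi>)\<in>\<A>. \<forall>(V, \<psi>)\<in>\<A>. \<forall>p\<in>U \<inter> V. \<forall>v w.
        (let D = frechet_derivative (\<psi> \<circ> inv_into U \<phi>) (at (\<phi> p))
         in g (U, \<phi>) (\<phi> p) v w = g (V, \<psi>) (\<psi> p) (D v) (D w)))"

text \<open>Connectedness makes the geodesic distance of any two points finite.\<close>

definition riemannian_manifold ::
    "('a::{t2_space,second_countable_topology}, 'e::euclidean_space) chart set
      \<Rightarrow> ('a, 'e) metric_tensor \<Rightarrow> bool" where
  "riemannian_manifold \<A> g \<longleftrightarrow>
     smooth_manifold \<A> \<and> riemannian_metric \<A> g \<and> connected (UNIV :: 'a set)"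


subsection \<open>Geodesic distance\<close>

text \<open>\<open>C\<^sup>1\<close> up to the end points \<open>a\<close>, \<open>b\<close>, where the derivative is one-sided.\<close>

definition C1_curve ::
    "('a::topological_space, 'e::euclidean_space) chart set \<Rightarrow> real \<Rightarrow> real \<Rightarrow> (real \<Rightarrow> 'a) \<Rightarrow> bool"
  where
  "C1_curve \<A> a b \<gamma> \<longleftrightarrow> continuous_on {a..b} \<gamma> \<and>
     (\<forall>(U, \<phi>)\<in>\<A>. \<exists>v. continuous_on ({a..b} \<inter> \<gamma> -` U) v \<and>
        (\<forall>t\<in>{a..b} \<inter> \<gamma> -` U. ((\<phi> \<circ> \<gamma>) has_vector_derivative v t) (at t within {a..b})))"

text \<open>The finite set \<open>S\<close> contains the possible break points of the curve.\<close>

definition piecewise_C1_curve ::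
    "('a::topological_space, 'e::euclidean_space) chart set \<Rightarrow> (real \<Rightarrow> 'a) \<Rightarrow> bool" where
  "piecewise_C1_curve \<A> \<gamma> \<longleftrightarrow> continuous_on {0..1} \<gamma> \<and>
     (\<exists>S. finite S \<and>
        (\<forall>a b. 0 \<le> a \<and> a < b \<and> b \<le> 1 \<and> {a<..<b} \<inter> S = {} \<longrightarrow> C1_curve \<A> a b \<gamma>))"

text \<open>By the transformation law, the speed does not depend on the chart chosen at \<open>\<gamma> t\<close>.\<close>

definition speed ::
    "('a, 'e::euclidean_space) chart set \<Rightarrow> ('a, 'e) metric_tensor \<Rightarrow> (real \<Rightarrow> 'a) \<Rightarrow> real \<Rightarrow> real"
  where
  "speed \<A> g \<gamma> t =
     (let c = (SOME c. c \<in> \<A> \<and> \<gamma> t \<in> fst c);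
          v = vector_derivative (snd c \<circ> \<gamma>) (at t)
      in sqrt (g c (snd c (\<gamma> t)) v v))"

definition curve_length ::
    "('a, 'e::euclidean_space) chart set \<Rightarrow> ('a, 'e) metric_tensor \<Rightarrow> (real \<Rightarrow> 'a) \<Rightarrow> real" where
  "curve_length \<A> g \<gamma> = integral {0..1} (speed \<A> g \<gamma>)"

definition geodesic_dist ::
    "('a::topological_space, 'e::euclidean_space) chart set \<Rightarrow> ('a, 'e) metric_tensor
      \<Rightarrow> 'a \<Rightarrow> 'a \<Rightarrow> real" where
  "geodesic_dist \<A> g x y =
     Inf {curve_length \<A> g \<gamma> | \<gamma>. piecewise_C1_curve \<A> \<gamma> \<and> \<gamma> 0 = x \<and> \<gamma> 1 = y}"


subsection \<open>Isometries\<close>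

definition smooth_map ::
    "('a::topological_space, 'e::euclidean_space) chart set \<Rightarrow> ('a \<Rightarrow> 'a) \<Rightarrow> bool" where
  "smooth_map \<A> f \<longleftrightarrow> continuous_on UNIV f \<and>
     (\<forall>(U, \<phi>)\<in>\<A>. \<forall>(V, \<psi>)\<in>\<A>. smooth_on (\<phi> ` (U \<inter> f -` V)) (\<psi> \<circ> f \<circ> inv_into U \<phi>))"

text \<open>A diffeomorphism of the manifold onto itself that pulls the metric tensor back to itself.\<close>

definition isometry ::
    "('a::topological_space, 'e::euclidean_space) chart set \<Rightarrow> ('a, 'e) metric_tensor
      \<Rightarrow> ('a \<Rightarrow> 'a) \<Rightarrow> bool" where
  "isometry \<A> g f \<longleftrightarrow>
     bij f \<and> smooth_map \<A> f \<and> smooth_map \<A> (inv f) \<and>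
     (\<forall>(U, \<phi>)\<in>\<A>. \<forall>(V, \<psi>)\<in>\<A>. \<forall>p\<in>U \<inter> f -` V. \<forall>v w.
        (let D = frechet_derivative (\<psi> \<circ> f \<circ> inv_into U \<phi>) (at (\<phi> p))
         in g (U, \<phi>) (\<phi> p) v w = g (V, \<psi>) (\<psi> (f p)) (D v) (D w)))"


section \<open>The nonlocal diffusion problem\<close>

text \<open>Elements of \<open>L\<^sup>1\<close> and \<open>L\<^sup>\<infinity>\<close> are represented by functions, with equality
  almost everywhere as the identification.\<close>

definition L1_norm :: "'a measure \<Rightarrow> ('a \<Rightarrow> real) \<Rightarrow> real" where
  "L1_norm \<mu> f = (\<integral>x. \<bar>f x\<bar> \<partial>\<mu>)"

definition Linf_norm :: "'a measure \<Rightarrow> ('a \<Rightarrow> real) \<Rightarrow> ennreal" where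
  "Linf_norm \<mu> f = esssup \<mu> (\<lambda>x. ennreal \<bar>f x\<bar>)"

definition in_Linf :: "'a measure \<Rightarrow> ('a \<Rightarrow> real) \<Rightarrow> bool" where
  "in_Linf \<mu> f \<longleftrightarrow> f \<in> borel_measurable \<mu> \<and> Linf_norm \<mu> f < \<infinity>"

text \<open>The operator \<open>L\<close>, for a distance function \<open>s\<close>. For \<open>u \<in> L\<^sup>1\<close> the integral
  converges for almost every \<open>x\<close>.\<close>

definition nonlocal_op ::
    "'a measure \<Rightarrow> ('a \<Rightarrow> 'a \<Rightarrow> real) \<Rightarrow> (real \<Rightarrow> real) \<Rightarrow> ('a \<Rightarrow> real) \<Rightarrow> 'a \<Rightarrow> real" where
  "nonlocal_op \<mu> s J u x = (\<integral>y. J (s x y) * u y \<partial>\<mu>) - u x"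

text \<open>Membership in \<open>C([0,\<infinity>); L\<^sup>1)\<close>; \<open>u t x\<close> stands for \<open>u(x,t)\<close>, and only \<open>t \<ge> 0\<close> matters.\<close>

definition continuous_L1 :: "'a measure \<Rightarrow> (real \<Rightarrow> 'a \<Rightarrow> real) \<Rightarrow> bool" where
  "continuous_L1 \<mu> u \<longleftrightarrow>
     (\<forall>t\<ge>0. integrable \<mu> (u t)) \<and>
     (\<forall>t\<ge>0. ((\<lambda>r. L1_norm \<mu> (\<lambda>x. u r x - u t x)) \<longlongrightarrow> 0) (at t within {0..}))"

text \<open>\<open>v \<in> L\<^sup>1\<close> is the derivative at time \<open>t\<close> of the \<open>L\<^sup>1\<close>-valued function \<open>u\<close>. Integrability of
  \<open>v\<close> has to be demanded, since the integral of a non-integrable function is 0.\<close>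

definition has_L1_derivative ::
    "'a measure \<Rightarrow> (real \<Rightarrow> 'a \<Rightarrow> real) \<Rightarrow> ('a \<Rightarrow> real) \<Rightarrow> real \<Rightarrow> bool" where
  "has_L1_derivative \<mu> u v t \<longleftrightarrow>
     integrable \<mu> v \<and>
     ((\<lambda>h. L1_norm \<mu> (\<lambda>x. (u (t + h) x - u t x) / h - v x)) \<longlongrightarrow> 0) (at 0)"

text \<open>Solutions in \<open>C([0,\<infinity>); L\<^sup>1)\<close> of \<open>u\<^sub>t - L u = 0\<close> in \<open>M \<times> (0,\<infinity>)\<close>,
  \<open>u(\<cdot>,0) = u\<^sub>0\<close>, with \<open>u\<^sub>t\<close> the derivative in \<open>L\<^sup>1\<close>.\<close>

definition cauchy_solution ::
    "'a measure \<Rightarrow> ('a \<Rightarrow> 'a \<Rightarrow> real) \<Rightarrow> (real \<Rightarrow> real) \<Rightarrow> ('a \<Rightarrow> real)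
      \<Rightarrow> (real \<Rightarrow> 'a \<Rightarrow> real) \<Rightarrow> bool" where
  "cauchy_solution \<mu> s J u0 u \<longleftrightarrow>
     continuous_L1 \<mu> u \<and>
     (\<forall>t>0. has_L1_derivative \<mu> u (nonlocal_op \<mu> s J (u t)) t) \<and>
     (AE x in \<mu>. u 0 x = u0 x)"

end

theory Submission
  imports Defs
begin

text \<open>Isometries preserve the length of piecewise \<open>C\<^sup>1\<close> curves, hence the geodesic distance \<open>s\<close>, and
  concatenating curves with short segments in charts shows that \<open>s\<close> is upper semicontinuous, hence
  jointly measurable. Moving \<open>x\<close> to \<open>O\<close> by \<open>\<tau>\<^sub>x\<close> then makes \<open>K(x, y) = J(s\<^sub>x\<^sub>y)\<close> a symmetric kernel all
  of whose marginals are 1, so \<open>T u(x) = \<integral> K(x, y) u(y) d\<mu>\<^sub>y\<close> is a contraction of both \<open>L\<^sup>1\<close> and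
  \<open>L\<^sup>\<infinity>\<close>. The solution is \<open>u(t) = \<Sum>\<^sub>n e\<^sup>-\<^sup>t t\<^sup>n / n! T\<^sup>n u\<^sub>0\<close>, an average of the \<open>T\<^sup>n u\<^sub>0\<close> with Poisson weights,
  and inherits their bounds. It is unique because \<open>N(t)\<close>, the \<open>L\<^sup>1\<close>-norm of the difference of two
  solutions, satisfies \<open>N(t) \<le> N(s) + 2 (t - s) N(\<xi>)\<close> for some \<open>\<xi>\<close> between \<open>s\<close> and \<open>t\<close>.\<close>

section \<open>\<open>C\<^sup>1\<close> curves and their speed\<close>

text \<open>\<open>speed\<close> uses a chosen chart and a two-sided derivative, so at break points
  and end points of a curve its value need not have geometric meaning. Lengths are therefore
  compared off finite sets, with one-sided velocities inside the pieces. The Poisson series is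
  exp(t(T - I)) = exp(-t) exp(tT). Splitting off the scalar factor replaces a series in powers of T
  - I, whose termwise norm bound would only be exp(2t), by an average with nonnegative weights of
  total mass 1; this is the source of the constant 1 in both estimates. Continuity and
  differentiability in time then concern only the weights as elements of l^1, where convexity or
  monotonicity in t fixes the signs and sums of absolute values collapse to differences of
  exponentials. In the uniqueness part the obstacle is that the norm N need not be differentiable,
  although the L^1-valued solutions are. The factor 2 is the bound of T - I on L^1.\<close>

lemma smooth_on_imp_C1:
  assumes "smooth_on S F"
  shows smooth_on_has_derivative: "x \<in> S \<Longrightarrow> (F has_derivative frechet_derivative F (at x)) (at x)"
    and smooth_on_continuous_derivative: "continuous_on S (\<lambda>x. frechet_derivative F (at x) v)"
proof -
  have "Ck_on (Suc 0) S F"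
    using assms unfolding smooth_on_def by blast
  then show "x \<in> S \<Longrightarrow> (F has_derivative frechet_derivative F (at x)) (at x)"
    and "continuous_on S (\<lambda>x. frechet_derivative F (at x) v)"
    by (auto simp: frechet_derivative_works[symmetric])
qed

lemma smooth_on_imp_continuous_on: "smooth_on S F \<Longrightarrow> continuous_on S F"
  unfolding smooth_on_def using Ck_on.simps(1) by blast

text \<open>Velocities are derivatives within the parameter interval, whereas chart formulas live on
  the preimage of a chart domain. That preimage is relatively open, so both sets give the same
  filter, end points included.\<close>

lemma at_within_relatively_open:
  fixes S :: "'a::topological_space set"
  assumes "openin (top_of_set S) T" "t \<in> T"
  shows "at t within T = at t within S"
proof -
  obtain W where W: "open W" "T = S \<inter> W"
    using assms(1) by (auto simp: openin_open)
  then show ?thesis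
    using assms(2) by (intro at_within_nhd[of t W]) auto
qed

lemma openin_curve_vimage:
  assumes "continuous_on {a..b::real} \<gamma>" "open U"
  shows "openin (top_of_set {a..b}) ({a..b} \<inter> \<gamma> -` U)"
  using assms by (rule continuous_openin_preimage_gen)

lemma at_within_curve_vimage:
  assumes "continuous_on {a..b::real} \<gamma>" "open U" "t \<in> {a..b}" "\<gamma> t \<in> U"
  shows "at t within ({a..b} \<inter> \<gamma> -` U) = at t within {a..b}"
  by (rule at_within_relatively_open) (use assms openin_curve_vimage in auto)

text \<open>Smoothness as defined yields continuity of a derivative in the base point for each fixed
  direction. Expanding the moving vector in the finite basis reduces the joint statement to that
  one.\<close>

lemma continuous_on_linear_family:
  fixes D :: "'b::topological_space \<Rightarrow> 'e::euclidean_space \<Rightarrow> 'c::real_normed_vector"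
  assumes lin: "\<And>x. x \<in> S \<Longrightarrow> linear (D x)"
    and cont: "\<And>v. continuous_on S (\<lambda>x. D x v)"
    and w: "continuous_on S w"
  shows "continuous_on S (\<lambda>x. D x (w x))"
proof -
  have "D x (w x) = (\<Sum>i\<in>Basis. (w x \<bullet> i) *\<^sub>R D x i)" if "x \<in> S" for x
  proof -
    interpret linear "D x" by (rule lin[OF that])
    have "D x (w x) = D x (\<Sum>i\<in>Basis. (w x \<bullet> i) *\<^sub>R i)"
      by (simp add: euclidean_representation)
    then show ?thesis by (simp add: sum scale)
  qed
  moreover have "continuous_on S (\<lambda>x. \<Sum>i\<in>Basis. (w x \<bullet> i) *\<^sub>R D x i)"
    by (intro continuous_intros cont w)
  ultimately show ?thesis by (simp cong: continuous_on_cong)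
qed

lemma continuous_on_bilinear_family:
  fixes B :: "'b::topological_space \<Rightarrow> 'e::euclidean_space \<Rightarrow> 'e \<Rightarrow> 'c::real_normed_vector"
  assumes bil: "\<And>x. x \<in> S \<Longrightarrow> bilinear (B x)"
    and cont: "\<And>v w. continuous_on S (\<lambda>x. B x v w)"
    and v: "continuous_on S v" and w: "continuous_on S w"
  shows "continuous_on S (\<lambda>x. B x (v x) (w x))"
proof (rule continuous_on_linear_family)
  show "linear (B x (v x))" if "x \<in> S" for x
    using bil[OF that] by (simp add: bilinear_def)
  show "continuous_on S (\<lambda>x. B x (v x) u)" for u
    by (rule continuous_on_linear_family[where D = "\<lambda>x v. B x v u"])
      (use bil cont v in \<open>auto simp: bilinear_def\<close>)
qed (rule w)

section \<open>Calculus of C^1 curves on an interval\<close>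

lemma C1_curve_imp_continuous_on: "C1_curve \<A> a b \<gamma> \<Longrightarrow> continuous_on {a..b} \<gamma>"
  by (simp add: C1_curve_def)

text \<open>The velocity in \<open>C1_curve\<close> is only asserted to exist. Derivatives within a
  nondegenerate interval are unique, so it has to be \<open>vector_derivative\<close>; this uses
  \<open>a < b\<close>.\<close>

lemma C1_curveD:
  assumes "C1_curve \<A> a b \<gamma>" "a < b" "(U, \<phi>) \<in> \<A>"
  defines "v \<equiv> \<lambda>t. vector_derivative (\<phi> \<circ> \<gamma>) (at t within {a..b})"
  shows C1_curve_continuous_derivative: "continuous_on ({a..b} \<inter> \<gamma> -` U) v"
    and C1_curve_has_vector_derivative:
      "t \<in> {a..b} \<Longrightarrow> \<gamma> t \<in> U \<Longrightarrow> ((\<phi> \<circ> \<gamma>) has_vector_derivative v t) (at t within {a..b})"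
proof -
  obtain w where w: "continuous_on ({a..b} \<inter> \<gamma> -` U) w"
      "\<And>t. t \<in> {a..b} \<Longrightarrow> \<gamma> t \<in> U \<Longrightarrow> ((\<phi> \<circ> \<gamma>) has_vector_derivative w t) (at t within {a..b})"
    using assms(1,3) unfolding C1_curve_def by fastforce
  have eq: "v t = w t" if "t \<in> {a..b}" "\<gamma> t \<in> U" for t
    unfolding v_def using w(2)[OF that] assms(2) that
    by (intro vector_derivative_within_closed_interval) auto
  show "continuous_on ({a..b} \<inter> \<gamma> -` U) v"
    using w(1) by (rule continuous_on_eq) (simp add: eq)
  show "t \<in> {a..b} \<Longrightarrow> \<gamma> t \<in> U \<Longrightarrow> ((\<phi> \<circ> \<gamma>) has_vector_derivative v t) (at t within {a..b})"
    using w(2) eq by simp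
qed

text \<open>The slope \<open>m\<close> may have either sign: slope 1 gives restriction to a
  subinterval, slope -1 reversal, slope 2 the two halves of a concatenation.\<close>

lemma C1_curve_affine:
  assumes \<gamma>: "C1_curve \<A> a' b' \<gamma>" and r: "r = (\<lambda>t. m * t + c)"
    and sub: "r ` {a..b} \<subseteq> {a'..b'}"
  shows "C1_curve \<A> a b (\<gamma> \<circ> r)"
  unfolding C1_curve_def
proof (intro conjI; clarify?)
  have contr: "continuous_on S r" for S
    unfolding r by (intro continuous_intros)
  show "continuous_on {a..b} (\<gamma> \<circ> r)"
    using contr C1_curve_imp_continuous_on[OF \<gamma>] sub continuous_on_compose continuous_on_subset by blast
  fix U \<phi> assume c: "(U, \<phi>) \<in> \<A>"
  obtain w where w: "continuous_on ({a'..b'} \<inter> \<gamma> -` U) w"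
      "\<And>t. t \<in> {a'..b'} \<Longrightarrow> \<gamma> t \<in> U \<Longrightarrow> ((\<phi> \<circ> \<gamma>) has_vector_derivative w t) (at t within {a'..b'})"
    using \<gamma> c unfolding C1_curve_def by fastforce
  show "\<exists>v. continuous_on ({a..b} \<inter> (\<gamma> \<circ> r) -` U) v \<and>
        (\<forall>t\<in>{a..b} \<inter> (\<gamma> \<circ> r) -` U. ((\<phi> \<circ> (\<gamma> \<circ> r)) has_vector_derivative v t) (at t within {a..b}))"
  proof (intro exI[of _ "\<lambda>t. m *\<^sub>R w (r t)"] conjI ballI)
    show "continuous_on ({a..b} \<inter> (\<gamma> \<circ> r) -` U) (\<lambda>t. m *\<^sub>R w (r t))"
      by (intro continuous_intros continuous_on_compose2[OF w(1) contr]) (use sub in auto)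
    fix t assume t: "t \<in> {a..b} \<inter> (\<gamma> \<circ> r) -` U"
    have "(r has_vector_derivative m) (at t within {a..b})"
      unfolding r by (auto intro!: derivative_eq_intros simp: has_real_derivative_iff_has_vector_derivative[symmetric])
    moreover have "((\<phi> \<circ> \<gamma>) has_vector_derivative w (r t)) (at (r t) within r ` {a..b})"
      by (rule has_vector_derivative_within_subset[OF w(2) sub])
        (use t sub in \<open>simp_all add: image_subset_iff\<close>)
    ultimately show "((\<phi> \<circ> (\<gamma> \<circ> r)) has_vector_derivative m *\<^sub>R w (r t)) (at t within {a..b})"
      unfolding o_assoc by (rule vector_diff_chain_within)
  qed
qed

lemma C1_curve_subset:
  assumes "C1_curve \<A> a' b' \<gamma>" "a' \<le> a" "b \<le> b'"
  shows "C1_curve \<A> a b \<gamma>"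
  using C1_curve_affine[OF assms(1), of "\<lambda>t. t" 1 0 a b] assms(2,3) by (simp add: o_def)

lemma C1_curve_cong:
  assumes \<gamma>: "C1_curve \<A> a b \<gamma>" and eq: "\<And>t. t \<in> {a..b} \<Longrightarrow> \<gamma> t = \<delta> t"
  shows "C1_curve \<A> a b \<delta>"
  unfolding C1_curve_def
proof (intro conjI; clarify?)
  show "continuous_on {a..b} \<delta>"
    using C1_curve_imp_continuous_on[OF \<gamma>] eq by (rule continuous_on_eq)
  fix U \<phi> assume c: "(U, \<phi>) \<in> \<A>"
  obtain w where w: "continuous_on ({a..b} \<inter> \<gamma> -` U) w"
      "\<And>t. t \<in> {a..b} \<Longrightarrow> \<gamma> t \<in> U \<Longrightarrow> ((\<phi> \<circ> \<gamma>) has_vector_derivative w t) (at t within {a..b})"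
    using \<gamma> c unfolding C1_curve_def by fastforce
  have vim: "{a..b} \<inter> \<delta> -` U = {a..b} \<inter> \<gamma> -` U"
    using eq by auto
  show "\<exists>v. continuous_on ({a..b} \<inter> \<delta> -` U) v \<and>
        (\<forall>t\<in>{a..b} \<inter> \<delta> -` U. ((\<phi> \<circ> \<delta>) has_vector_derivative v t) (at t within {a..b}))"
  proof (intro exI[of _ w] conjI ballI)
    show "continuous_on ({a..b} \<inter> \<delta> -` U) w"
      using w(1) vim by simp
    fix t assume t: "t \<in> {a..b} \<inter> \<delta> -` U"
    show "((\<phi> \<circ> \<delta>) has_vector_derivative w t) (at t within {a..b})"
      by (rule has_vector_derivative_transform_within[OF w(2)[of t], of 1]) (use t eq in auto)
  qed
qed

section \<open>The manifold in charts, and images of curves under smooth maps\<close>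

locale riemannian =
  fixes \<A> :: "('a::{t2_space,second_countable_topology}, 'e::euclidean_space) chart set"
    and g :: "('a, 'e) metric_tensor"
  assumes manifold: "riemannian_manifold \<A> g"
begin

lemma assumes "(U, \<phi>) \<in> \<A>"
  shows chart_open: "open U"
    and chart_image_open: "open (\<phi> ` U)"
    and chart_homeomorphism: "homeomorphism U (\<phi> ` U) \<phi> (inv_into U \<phi>)"
proof -
  have "is_chart (U, \<phi>)"
    using manifold assms unfolding riemannian_manifold_def smooth_manifold_def by blast
  then show "open U" "open (\<phi> ` U)" "homeomorphism U (\<phi> ` U) \<phi> (inv_into U \<phi>)"
    by (simp_all add: is_chart_def)
qed

lemma chart_inv: "(U, \<phi>) \<in> \<A> \<Longrightarrow> x \<in> U \<Longrightarrow> inv_into U \<phi> (\<phi> x) = x"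
  using chart_homeomorphism by (meson homeomorphism_apply1)

lemma chart_continuous_on: "(U, \<phi>) \<in> \<A> \<Longrightarrow> continuous_on U \<phi>"
  using chart_homeomorphism homeomorphism_cont1 by blast

lemma ex_chart:
  obtains U \<phi> where "(U, \<phi>) \<in> \<A>" "x \<in> U"
  using manifold unfolding riemannian_manifold_def smooth_manifold_def by blast

lemma assumes c: "(U, \<phi>) \<in> \<A>"
  shows metric_bilinear: "q \<in> \<phi> ` U \<Longrightarrow> bilinear (g (U, \<phi>) q)"
    and metric_pos: "q \<in> \<phi> ` U \<Longrightarrow> v \<noteq> 0 \<Longrightarrow> 0 < g (U, \<phi>) q v v"
    and metric_continuous_on: "continuous_on (\<phi> ` U) (\<lambda>q. g (U, \<phi>) q v w)"
proof -
  have *: "\<forall>(U, \<phi>)\<in>\<A>. \<forall>q\<in>\<phi> ` U. bilinear (g (U, \<phi>) q) \<and>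
        (\<forall>v w. g (U, \<phi>) q v w = g (U, \<phi>) q w v) \<and> (\<forall>v. v \<noteq> 0 \<longrightarrow> 0 < g (U, \<phi>) q v v)"
    and **: "\<forall>(U, \<phi>)\<in>\<A>. \<forall>v w. smooth_on (\<phi> ` U) (\<lambda>q. g (U, \<phi>) q v w)"
    using manifold unfolding riemannian_manifold_def riemannian_metric_def by blast+
  show "q \<in> \<phi> ` U \<Longrightarrow> bilinear (g (U, \<phi>) q)"
    and "q \<in> \<phi> ` U \<Longrightarrow> v \<noteq> 0 \<Longrightarrow> 0 < g (U, \<phi>) q v v"
    using bspec[OF * c, unfolded split] by blast+
  show "continuous_on (\<phi> ` U) (\<lambda>q. g (U, \<phi>) q v w)"
    using bspec[OF ** c, unfolded split] by (simp add: smooth_on_imp_continuous_on)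
qed

lemma metric_continuous:
  assumes "(U, \<phi>) \<in> \<A>" "continuous_on S q" "continuous_on S v" "q ` S \<subseteq> \<phi> ` U"
  shows "continuous_on S (\<lambda>t. g (U, \<phi>) (q t) (v t) (v t))"
proof (rule continuous_on_bilinear_family[where B = "\<lambda>t. g (U, \<phi>) (q t)"])
  show "bilinear (g (U, \<phi>) (q t))" if "t \<in> S" for t
    using that assms by (intro metric_bilinear) auto
  show "continuous_on S (\<lambda>t. g (U, \<phi>) (q t) v w)" for v w
    by (rule continuous_on_compose2[OF metric_continuous_on[OF assms(1)] assms(2,4)])
qed (fact assms)+

text \<open>Transition maps are the local representatives of the identity, so the transformation law
  of the metric is literally the isometry condition for \<open>id\<close>. Independence of the chart
  thereby becomes a special case of invariance under isometries.\<close>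

lemma isometry_id: "isometry \<A> g id"
proof -
  have "smooth_map \<A> id"
    using manifold unfolding smooth_map_def riemannian_manifold_def smooth_manifold_def by simp
  moreover have "\<forall>(U, \<phi>)\<in>\<A>. \<forall>(V, \<psi>)\<in>\<A>. \<forall>p\<in>U \<inter> V. \<forall>v w.
      (let D = frechet_derivative (\<psi> \<circ> inv_into U \<phi>) (at (\<phi> p))
       in g (U, \<phi>) (\<phi> p) v w = g (V, \<psi>) (\<psi> p) (D v) (D w))"
    using manifold unfolding riemannian_manifold_def riemannian_metric_def by blast
  ultimately show ?thesis
    by (simp add: isometry_def inv_id)
qed

lemma smooth_map_id: "smooth_map \<A> id"
  using isometry_id by (simp add: isometry_def)

text \<open>The local representative of \<open>f\<close> turns
  \<open>\<phi> \<circ> \<gamma>\<close> into \<open>\<psi> \<circ> (f \<circ> \<gamma>)\<close>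
  only while the curve stays in \<open>U\<close>. As \<open>U\<close> is open, this holds near
  \<open>t\<close>, which suffices for the derivative at \<open>t\<close>.\<close>

lemma smooth_map_curve_deriv:
  assumes f: "smooth_map \<A> f" and c: "(U, \<phi>) \<in> \<A>" "(V, \<psi>) \<in> \<A>"
    and cont: "continuous_on {a..b} \<gamma>" and t: "t \<in> {a..b}" "\<gamma> t \<in> U" "f (\<gamma> t) \<in> V"
    and w: "((\<phi> \<circ> \<gamma>) has_vector_derivative w) (at t within {a..b})"
  shows "((\<psi> \<circ> (f \<circ> \<gamma>)) has_vector_derivative
     frechet_derivative (\<psi> \<circ> f \<circ> inv_into U \<phi>) (at (\<phi> (\<gamma> t))) w) (at t within {a..b})"
proof -
  let ?G = "\<psi> \<circ> f \<circ> inv_into U \<phi>"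
  have smooth: "smooth_on (\<phi> ` (U \<inter> f -` V)) ?G" and contf: "continuous_on UNIV f"
    using f c unfolding smooth_map_def by auto
  have "(?G has_derivative frechet_derivative ?G (at (\<phi> (\<gamma> t)))) (at (\<phi> (\<gamma> t)))"
    by (rule smooth_on_has_derivative[OF smooth]) (use t in auto)
  then have "(?G has_derivative frechet_derivative ?G (at ((\<phi> \<circ> \<gamma>) t))) (at ((\<phi> \<circ> \<gamma>) t) within (\<phi> \<circ> \<gamma>) ` {a..b})"
    by (simp add: has_derivative_at_withinI)
  then have "((?G \<circ> (\<phi> \<circ> \<gamma>)) has_vector_derivative frechet_derivative ?G (at (\<phi> (\<gamma> t))) w) (at t within {a..b})"
    using vector_derivative_diff_chain_within[OF w] by simp
  moreover have "\<forall>\<^sub>F s in at t within {a..b}. (?G \<circ> (\<phi> \<circ> \<gamma>)) s = (\<psi> \<circ> (f \<circ> \<gamma>)) s"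
  proof -
    have "\<forall>\<^sub>F s in at t within {a..b}. s \<in> {a..b} \<inter> \<gamma> -` U"
      unfolding at_within_curve_vimage[OF cont chart_open[OF c(1)] t(1,2), symmetric]
      by (simp add: eventually_at_filter)
    then show ?thesis
      by eventually_elim (simp add: chart_inv[OF c(1)])
  qed
  ultimately show ?thesis
    unfolding has_vector_derivative_def
    by (rule has_derivative_transform_eventually) (use t chart_inv[OF c(1)] in auto)
qed

text \<open>The hypothesis \<open>loc\<close> asks for a continuous velocity in one chart around
  each point, whereas \<open>C1_curve\<close> asks for it in all charts. With \<open>f = id\<close>
  this is the criterion by which a curve is recognised as C^1 from a single chart.\<close>

lemma C1_curve_smooth_map:
  assumes f: "smooth_map \<A> f" and "a < b" and cont: "continuous_on {a..b} \<gamma>"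
    and loc: "\<And>t. t \<in> {a..b} \<Longrightarrow> \<exists>U \<phi> w. (U, \<phi>) \<in> \<A> \<and> \<gamma> t \<in> U \<and> continuous_on ({a..b} \<inter> \<gamma> -` U) w \<and>
        (\<forall>s\<in>{a..b} \<inter> \<gamma> -` U. ((\<phi> \<circ> \<gamma>) has_vector_derivative w s) (at s within {a..b}))"
  shows "C1_curve \<A> a b (f \<circ> \<gamma>)"
  unfolding C1_curve_def
proof (intro conjI; clarify?)
  have contf: "continuous_on UNIV f"
    using f by (simp add: smooth_map_def)
  show contf\<gamma>: "continuous_on {a..b} (f \<circ> \<gamma>)"
    using contf cont continuous_on_compose continuous_on_subset by blast
  fix V \<psi> assume c': "(V, \<psi>) \<in> \<A>"
  let ?T = "{a..b} \<inter> (f \<circ> \<gamma>) -` V"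
  \<comment> \<open>This choice of velocity does not mention the auxiliary chart around a point, so
    the local continuity statements fit together.\<close>
  let ?v = "\<lambda>t. vector_derivative (\<psi> \<circ> (f \<circ> \<gamma>)) (at t within {a..b})"
  have *: "continuous (at t within ?T) ?v \<and> ((\<psi> \<circ> (f \<circ> \<gamma>)) has_vector_derivative ?v t) (at t within {a..b})"
    if t: "t \<in> ?T" for t
  proof -
    obtain U \<phi> w where c: "(U, \<phi>) \<in> \<A>" and tU: "\<gamma> t \<in> U" and w: "continuous_on ({a..b} \<inter> \<gamma> -` U) w"
        "\<And>s. s \<in> {a..b} \<inter> \<gamma> -` U \<Longrightarrow> ((\<phi> \<circ> \<gamma>) has_vector_derivative w s) (at s within {a..b})"
      using loc[of t] t by auto
    let ?G = "\<psi> \<circ> f \<circ> inv_into U \<phi>"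
    let ?S = "{a..b} \<inter> \<gamma> -` (U \<inter> f -` V)"
    have smooth: "smooth_on (\<phi> ` (U \<inter> f -` V)) ?G"
      using f c c' unfolding smooth_map_def by auto
    have openUV: "open (U \<inter> f -` V)"
      using chart_open[OF c] chart_open[OF c'] contf
      by (simp add: open_Int open_vimage)
    have D: "((\<psi> \<circ> (f \<circ> \<gamma>)) has_vector_derivative
        frechet_derivative ?G (at (\<phi> (\<gamma> s))) (w s)) (at s within {a..b})" if "s \<in> ?S" for s
      by (rule smooth_map_curve_deriv[OF f c c' cont]) (use that w(2) in auto)
    have eq: "?v s = frechet_derivative ?G (at (\<phi> (\<gamma> s))) (w s)" if "s \<in> ?S" for s
      using D[OF that] \<open>a < b\<close> that by (intro vector_derivative_within_closed_interval) auto
    have "continuous_on ?S (\<lambda>s. frechet_derivative ?G (at (\<phi> (\<gamma> s))) (w s))"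
    proof (rule continuous_on_linear_family[where D = "\<lambda>s. frechet_derivative ?G (at (\<phi> (\<gamma> s)))" and w = w])
      show "linear (frechet_derivative ?G (at (\<phi> (\<gamma> s))))" if "s \<in> ?S" for s
        using smooth_on_has_derivative[OF smooth, of "\<phi> (\<gamma> s)"] that has_derivative_linear by auto
      have "continuous_on ?S (\<lambda>s. \<phi> (\<gamma> s))"
        by (intro continuous_on_compose2[OF chart_continuous_on[OF c]] continuous_on_subset[OF cont]) auto
      then show "continuous_on ?S (\<lambda>s. frechet_derivative ?G (at (\<phi> (\<gamma> s))) v)" for v
        by (rule continuous_on_compose2[OF smooth_on_continuous_derivative[OF smooth]]) auto
      show "continuous_on ?S w"
        using w(1) by (rule continuous_on_subset) auto
    qed
    then have "continuous_on ?S ?v"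
      by (rule continuous_on_eq) (simp add: eq)
    moreover have tS: "t \<in> ?S"
      using t tU by auto
    ultimately have "continuous (at t within ?S) ?v"
      by (simp add: continuous_on_eq_continuous_within)
    moreover have "at t within ?S = at t within {a..b}"
      using at_within_curve_vimage[OF cont openUV, of t] tS by auto
    moreover have "at t within ?T = at t within {a..b}"
      using at_within_curve_vimage[OF contf\<gamma> chart_open[OF c'], of t] t by auto
    ultimately show ?thesis
      using D[OF tS] eq[OF tS] by simp
  qed
  then have "continuous_on ?T ?v"
    using continuous_on_eq_continuous_within by blast
  with * show "\<exists>v. continuous_on ?T v \<and>
      (\<forall>t\<in>?T. ((\<psi> \<circ> (f \<circ> \<gamma>)) has_vector_derivative v t) (at t within {a..b}))"
    by blast
qed

lemma C1_curve_comp: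
  assumes f: "smooth_map \<A> f" and "a < b" and \<gamma>: "C1_curve \<A> a b \<gamma>"
  shows "C1_curve \<A> a b (f \<circ> \<gamma>)"
proof (rule C1_curve_smooth_map[OF f \<open>a < b\<close> C1_curve_imp_continuous_on[OF \<gamma>]])
  fix t assume "t \<in> {a..b}"
  obtain U \<phi> where c: "(U, \<phi>) \<in> \<A>" "\<gamma> t \<in> U" by (rule ex_chart)
  then obtain w where "continuous_on ({a..b} \<inter> \<gamma> -` U) w"
      "\<forall>s\<in>{a..b} \<inter> \<gamma> -` U. ((\<phi> \<circ> \<gamma>) has_vector_derivative w s) (at s within {a..b})"
    using \<gamma> unfolding C1_curve_def by fastforce
  with c show "\<exists>U \<phi> w. (U, \<phi>) \<in> \<A> \<and> \<gamma> t \<in> U \<and> continuous_on ({a..b} \<inter> \<gamma> -` U) w \<and>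
        (\<forall>s\<in>{a..b} \<inter> \<gamma> -` U. ((\<phi> \<circ> \<gamma>) has_vector_derivative w s) (at s within {a..b}))"
    by blast
qed

text \<open>The variant of \<open>speed\<close> with the chart as an argument and the derivative
  within \<open>I\<close>. With \<open>I\<close> the closed parameter interval of a C^1 piece it is
  meaningful at the end points too.\<close>

definition speed_within :: "real set \<Rightarrow> (real \<Rightarrow> 'a) \<Rightarrow> ('a, 'e) chart \<Rightarrow> real \<Rightarrow> real" where
  "speed_within I \<gamma> c t =
     (let v = vector_derivative (snd c \<circ> \<gamma>) (at t within I) in sqrt (g c (snd c (\<gamma> t)) v v))"

definition chart_at :: "'a \<Rightarrow> ('a, 'e) chart" where
  "chart_at x = (SOME c. c \<in> \<A> \<and> x \<in> fst c)"

lemma chart_at: "chart_at x \<in> \<A>" "x \<in> fst (chart_at x)"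
proof -
  have "\<exists>c. c \<in> \<A> \<and> x \<in> fst c"
    using ex_chart[of x] by (metis fst_conv)
  then show "chart_at x \<in> \<A>" "x \<in> fst (chart_at x)"
    unfolding chart_at_def by (metis (mono_tags, lifting) someI_ex)+
qed

lemma speed_eq: "speed \<A> g \<gamma> t = speed_within UNIV \<gamma> (chart_at (\<gamma> t)) t"
  by (simp add: speed_def speed_within_def chart_at_def Let_def)

text \<open>The chain rule sends the velocity \<open>?w\<close> to \<open>?D ?w\<close>, and the
  isometry condition says that \<open>?D\<close> preserves the inner product. The two charts are
  arbitrary, so taking the identity for \<open>f\<close> yields independence of the chart.\<close>

lemma speed_within_isometry:
  assumes f: "isometry \<A> g f" and \<gamma>: "C1_curve \<A> a b \<gamma>" and "a < b" and t: "t \<in> {a..b}"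
    and c: "c \<in> \<A>" "\<gamma> t \<in> fst c" and c': "c' \<in> \<A>" "f (\<gamma> t) \<in> fst c'"
  shows "speed_within {a..b} (f \<circ> \<gamma>) c' t = speed_within {a..b} \<gamma> c t"
proof -
  obtain U \<phi> V \<psi> where [simp]: "c = (U, \<phi>)" "c' = (V, \<psi>)" by fastforce
  have c: "(U, \<phi>) \<in> \<A>" "\<gamma> t \<in> U" and c': "(V, \<psi>) \<in> \<A>" "f (\<gamma> t) \<in> V"
    using c c' by auto
  have smooth: "smooth_map \<A> f"
    using f by (simp add: isometry_def)
  let ?w = "vector_derivative (\<phi> \<circ> \<gamma>) (at t within {a..b})"
  let ?D = "frechet_derivative (\<psi> \<circ> f \<circ> inv_into U \<phi>) (at (\<phi> (\<gamma> t)))"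
  have "((\<psi> \<circ> (f \<circ> \<gamma>)) has_vector_derivative ?D ?w) (at t within {a..b})"
    by (rule smooth_map_curve_deriv[OF smooth c(1) c'(1) C1_curve_imp_continuous_on[OF \<gamma>] t c(2) c'(2)
          C1_curve_has_vector_derivative[OF \<gamma> \<open>a < b\<close> c(1) t c(2)]])
  then have "vector_derivative (\<psi> \<circ> (f \<circ> \<gamma>)) (at t within {a..b}) = ?D ?w"
    using \<open>a < b\<close> t by (intro vector_derivative_within_closed_interval) auto
  moreover have "g (U, \<phi>) (\<phi> (\<gamma> t)) ?w ?w = g (V, \<psi>) (\<psi> (f (\<gamma> t))) (?D ?w) (?D ?w)"
    using bspec[OF bspec[OF f[unfolded isometry_def, THEN conjunct2, THEN conjunct2, THEN conjunct2] c(1),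
          unfolded split] c'(1), unfolded split] c c' by (auto simp: Let_def)
  ultimately show ?thesis
    by (simp add: speed_within_def Let_def)
qed

lemma speed_within_chart:
  assumes "C1_curve \<A> a b \<gamma>" "a < b" "t \<in> {a..b}"
    and "c \<in> \<A>" "\<gamma> t \<in> fst c" "c' \<in> \<A>" "\<gamma> t \<in> fst c'"
  shows "speed_within {a..b} \<gamma> c t = speed_within {a..b} \<gamma> c' t"
  using speed_within_isometry[OF isometry_id assms(1-5), of c'] assms(6,7) by simp

lemma speed_interior:
  assumes \<gamma>: "C1_curve \<A> a b \<gamma>" and t: "t \<in> {a<..<b}" and c: "c \<in> \<A>" "\<gamma> t \<in> fst c"
  shows "speed \<A> g \<gamma> t = speed_within {a..b} \<gamma> c t"
proof -
  have "at t within {a..b} = at t"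
    using t by (intro at_within_Icc_at) auto
  then have "speed \<A> g \<gamma> t = speed_within {a..b} \<gamma> (chart_at (\<gamma> t)) t"
    by (simp add: speed_eq speed_within_def)
  also have "\<dots> = speed_within {a..b} \<gamma> c t"
    by (rule speed_within_chart[OF \<gamma>]) (use t c chart_at in auto)
  finally show ?thesis .
qed

lemma speed_isometry:
  assumes f: "isometry \<A> g f" and \<gamma>: "C1_curve \<A> a b \<gamma>" and t: "t \<in> {a<..<b}"
  shows "speed \<A> g (f \<circ> \<gamma>) t = speed \<A> g \<gamma> t"
proof -
  have ab: "a < b" "t \<in> {a..b}" using t by auto
  have "C1_curve \<A> a b (f \<circ> \<gamma>)"
    using f ab \<gamma> by (intro C1_curve_comp) (auto simp: isometry_def)
  then have "speed \<A> g (f \<circ> \<gamma>) t = speed_within {a..b} (f \<circ> \<gamma>) (chart_at (f (\<gamma> t))) t"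
    by (rule speed_interior[OF _ t chart_at(1)]) (use chart_at in auto)
  also have "\<dots> = speed_within {a..b} \<gamma> (chart_at (\<gamma> t)) t"
    using speed_within_isometry[OF f \<gamma> ab] chart_at by blast
  also have "\<dots> = speed \<A> g \<gamma> t"
    by (rule speed_interior[OF \<gamma> t, symmetric]) (use chart_at in auto)
  finally show ?thesis .
qed

lemma speed_nonneg_C1:
  assumes \<gamma>: "C1_curve \<A> a b \<gamma>" and t: "t \<in> {a<..<b}"
  shows "0 \<le> speed \<A> g \<gamma> t"
proof -
  obtain U \<phi> where c: "(U, \<phi>) \<in> \<A>" "\<gamma> t \<in> U" by (rule ex_chart)
  have "0 \<le> g (U, \<phi>) (\<phi> (\<gamma> t)) v v" for v
    using metric_pos[OF c(1), of "\<phi> (\<gamma> t)" v] metric_bilinear[OF c(1), of "\<phi> (\<gamma> t)"] c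
    by (cases "v = 0") (auto simp: bilinear_lzero less_imp_le)
  then show ?thesis
    using speed_interior[OF \<gamma> t c(1)] c by (simp add: speed_within_def Let_def)
qed

text \<open>Up to the two end points, \<open>speed\<close> is the one-sided speed
  \<open>?\<sigma>\<close>, which is continuous: the chosen chart may jump along the curve, but by
  chart independence it can be replaced near each \<open>t\<close> by one fixed chart.\<close>

lemma speed_integrable_C1:
  assumes \<gamma>: "C1_curve \<A> a b \<gamma>" and ab: "a < b"
  shows "speed \<A> g \<gamma> integrable_on {a..b}"
proof -
  let ?\<sigma> = "\<lambda>t. speed_within {a..b} \<gamma> (chart_at (\<gamma> t)) t"
  have "continuous_on {a..b} ?\<sigma>"
    unfolding continuous_on_eq_continuous_within
  proof
    fix t assume t: "t \<in> {a..b}"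
    obtain U \<phi> where c: "(U, \<phi>) \<in> \<A>" "\<gamma> t \<in> U" by (rule ex_chart)
    let ?T = "{a..b} \<inter> \<gamma> -` U"
    have "continuous_on ?T (speed_within {a..b} \<gamma> (U, \<phi>))"
      unfolding speed_within_def Let_def snd_conv
      by (intro continuous_on_real_sqrt metric_continuous[OF c(1)]
          C1_curve_continuous_derivative[OF \<gamma> ab c(1)]
          continuous_on_compose2[OF chart_continuous_on[OF c(1)]]
          continuous_on_subset[OF C1_curve_imp_continuous_on[OF \<gamma>]]) auto
    then have "continuous_on ?T ?\<sigma>"
      by (rule continuous_on_eq) (use chart_at c in \<open>auto intro!: speed_within_chart[OF \<gamma> ab]\<close>)
    then have "continuous (at t within ?T) ?\<sigma>"
      using t c by (auto simp: continuous_on_eq_continuous_within)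
    then show "continuous (at t within {a..b}) ?\<sigma>"
      using at_within_curve_vimage[OF C1_curve_imp_continuous_on[OF \<gamma>] chart_open[OF c(1)] t c(2)] by simp
  qed
  then have "?\<sigma> integrable_on {a..b}"
    by (rule integrable_continuous_real)
  moreover have "speed \<A> g \<gamma> t = ?\<sigma> t" if "t \<in> {a<..<b}" for t
    using speed_interior[OF \<gamma> that chart_at] by simp
  then have "speed \<A> g \<gamma> t = ?\<sigma> t" if "t \<in> {a..b} - {a, b}" for t
    using that by auto
  ultimately show ?thesis
    using integrable_spike_finite[of "{a, b}" "{a..b}" "speed \<A> g \<gamma>" ?\<sigma>] by blast
qed

end


section \<open>Length of piecewise \<open>C\<^sup>1\<close> curves and the geodesic distance\<close>

lemma has_integral_affinity_interval:
  fixes f :: "real \<Rightarrow> 'b::real_normed_vector"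
  assumes "(f has_integral i) {m * a + c..m * b + c}" "0 < m"
  shows "((\<lambda>t. m *\<^sub>R f (m * t + c)) has_integral i) {a..b}"
proof -
  have "(m * a + c - c) /\<^sub>R m = a" "(m * b + c - c) /\<^sub>R m = b"
    using assms(2) by auto
  then have "((\<lambda>t. f (m * t + c)) has_integral i /\<^sub>R m) {a..b}"
    using has_integral_affinity'[of f i "m * a + c" "m * b + c" m c] assms
    by (simp add: mult.assoc[symmetric])
  from has_integral_cmul[OF this, of m] show ?thesis
    using assms(2) by simp
qed

lemma piecewise_C1_curveE:
  assumes "piecewise_C1_curve \<A> \<gamma>"
  obtains S where "finite S" "continuous_on {0..1} \<gamma>"
    "\<And>a b. 0 \<le> a \<Longrightarrow> a < b \<Longrightarrow> b \<le> 1 \<Longrightarrow> {a<..<b} \<inter> S = {} \<Longrightarrow> C1_curve \<A> a b \<gamma>"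
  using assms unfolding piecewise_C1_curve_def by blast

text \<open>Speed is independent of the chart and transforms correctly at interior points of C^1
  pieces. All parameters outside a finite, hence negligible, set are of this kind.\<close>

lemma piecewise_C1_curve_regular_points:
  assumes "piecewise_C1_curve \<A> \<gamma>"
  obtains S where "finite S"
    "\<And>t. t \<in> {0..1} - S \<Longrightarrow> \<exists>a b. 0 \<le> a \<and> a < t \<and> t < b \<and> b \<le> 1 \<and> C1_curve \<A> a b \<gamma>"
proof -
  obtain S where S: "finite S"
    "\<And>a b. 0 \<le> a \<Longrightarrow> a < b \<Longrightarrow> b \<le> 1 \<Longrightarrow> {a<..<b} \<inter> S = {} \<Longrightarrow> C1_curve \<A> a b \<gamma>"
    using assms by (rule piecewise_C1_curveE) blast
  \<comment> \<open>With 0 and 1 among the exceptional points, the interval of radius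
    \<open>d\<close> about \<open>t\<close> stays inside the unit interval.\<close>
  let ?S = "insert 0 (insert 1 S)"
  show ?thesis
  proof (rule that[of ?S])
    fix t assume t: "t \<in> {0..1} - ?S"
    obtain d where d: "d > 0" "\<forall>s\<in>?S. s \<noteq> t \<longrightarrow> d \<le> dist t s"
      using finite_set_avoid[of ?S t] S(1) by auto
    have "\<bar>t\<bar> \<ge> d" "\<bar>t - 1\<bar> \<ge> d"
      using d(2) t by (auto simp: dist_real_def)
    then have "0 \<le> t - d" "t + d \<le> 1"
      using t by auto
    moreover have "{t - d<..<t + d} \<inter> S = {}"
      using d t by (force simp: dist_real_def)
    ultimately show "\<exists>a b. 0 \<le> a \<and> a < t \<and> t < b \<and> b \<le> 1 \<and> C1_curve \<A> a b \<gamma>"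
      using S(2)[of "t - d" "t + d"] d(1) by (intro exI[of _ "t - d"] exI[of _ "t + d"]) auto
  qed (use S in simp)
qed

context riemannian
begin

section \<open>Length of piecewise C^1 curves: isometries, reversal, concatenation\<close>

lemma piecewise_C1_curve_comp:
  assumes f: "smooth_map \<A> f" and \<gamma>: "piecewise_C1_curve \<A> \<gamma>"
  shows "piecewise_C1_curve \<A> (f \<circ> \<gamma>)"
proof -
  obtain S where S: "finite S" "continuous_on {0..1} \<gamma>"
    "\<And>a b. 0 \<le> a \<Longrightarrow> a < b \<Longrightarrow> b \<le> 1 \<Longrightarrow> {a<..<b} \<inter> S = {} \<Longrightarrow> C1_curve \<A> a b \<gamma>"
    using \<gamma> by (rule piecewise_C1_curveE) blast
  have "continuous_on {0..1} (f \<circ> \<gamma>)"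
    using f S(2) continuous_on_subset unfolding smooth_map_def by (blast intro: continuous_on_compose)
  then show ?thesis
    unfolding piecewise_C1_curve_def using S(1) C1_curve_comp[OF f _ S(3)]
    by (intro conjI exI[of _ S]) auto
qed

text \<open>Integrability on all sufficiently small intervals around each point suffices. A small
  interval around \<open>x\<close> contains no break point other than possibly \<open>x\<close>, and
  is split there into two pieces.\<close>

lemma speed_integrable:
  assumes "piecewise_C1_curve \<A> \<gamma>"
  shows "speed \<A> g \<gamma> integrable_on {0..1}"
proof -
  obtain S where S: "finite S"
    "\<And>a b. 0 \<le> a \<Longrightarrow> a < b \<Longrightarrow> b \<le> 1 \<Longrightarrow> {a<..<b} \<inter> S = {} \<Longrightarrow> C1_curve \<A> a b \<gamma>"
    using assms by (rule piecewise_C1_curveE) blast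
  have sub: "speed \<A> g \<gamma> integrable_on {a..b}"
    if "0 \<le> a" "a \<le> b" "b \<le> 1" "{a<..<b} \<inter> S = {}" for a b
    using that S(2)[of a b] speed_integrable_C1[of a b \<gamma>] integrable_on_refl[of "speed \<A> g \<gamma>" b]
    by (cases "a = b") auto
  have "speed \<A> g \<gamma> integrable_on cbox 0 1"
  proof (rule integrable_on_little_subintervals, rule)
    fix x :: real assume x: "x \<in> cbox 0 1"
    obtain d where d: "d > 0" "\<forall>s\<in>S. s \<noteq> x \<longrightarrow> d \<le> dist x s"
      using finite_set_avoid[OF S(1)] by blast
    have "speed \<A> g \<gamma> integrable_on cbox u v"
      if H: "x \<in> cbox u v" "cbox u v \<subseteq> ball x d" "cbox u v \<subseteq> cbox 0 1" for u v
    proof -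
      have uv: "u \<le> x" "x \<le> v" "0 \<le> u" "v \<le> 1"
        using H by auto
      have "s \<notin> S" if "s \<in> {u..v}" "s \<noteq> x" for s
        using that d(2) H(2) by (force simp: dist_real_def)
      then have "{u<..<x} \<inter> S = {}" "{x<..<v} \<inter> S = {}"
        using uv by force+
      then have "speed \<A> g \<gamma> integrable_on {u..x}" "speed \<A> g \<gamma> integrable_on {x..v}"
        using sub uv by auto
      then show ?thesis
        using uv Henstock_Kurzweil_Integration.integrable_combine[of u x v] by (simp add: cbox_interval)
    qed
    then show "\<exists>d>0. \<forall>u v. x \<in> cbox u v \<and> cbox u v \<subseteq> ball x d \<and> cbox u v \<subseteq> cbox 0 1 \<longrightarrow>
        speed \<A> g \<gamma> integrable_on cbox u v"
      using d(1) by blast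
  qed
  then show ?thesis by simp
qed

lemma curve_length_has_integral:
  "piecewise_C1_curve \<A> \<gamma> \<Longrightarrow> (speed \<A> g \<gamma> has_integral curve_length \<A> g \<gamma>) {0..1}"
  unfolding curve_length_def using speed_integrable by (rule integrable_integral)

lemma curve_length_nonneg:
  assumes "piecewise_C1_curve \<A> \<gamma>"
  shows "0 \<le> curve_length \<A> g \<gamma>"
proof -
  obtain S where S: "finite S"
    "\<And>t. t \<in> {0..1} - S \<Longrightarrow> \<exists>a b. 0 \<le> a \<and> a < t \<and> t < b \<and> b \<le> 1 \<and> C1_curve \<A> a b \<gamma>"
    using assms by (rule piecewise_C1_curve_regular_points) blast
  have abs: "\<bar>speed \<A> g \<gamma> t\<bar> = speed \<A> g \<gamma> t" if t: "t \<in> {0..1} - S" for t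
    using S(2)[OF t] speed_nonneg_C1 by fastforce
  have "((\<lambda>t. \<bar>speed \<A> g \<gamma> t\<bar>) has_integral curve_length \<A> g \<gamma>) {0..1}"
    by (rule has_integral_spike_finite[OF S(1) abs curve_length_has_integral[OF assms]])
  then show ?thesis
    by (rule has_integral_nonneg) simp
qed

lemma curve_length_isometry:
  assumes f: "isometry \<A> g f" and "piecewise_C1_curve \<A> \<gamma>"
  shows "curve_length \<A> g (f \<circ> \<gamma>) = curve_length \<A> g \<gamma>"
proof -
  obtain S where S: "finite S"
    "\<And>t. t \<in> {0..1} - S \<Longrightarrow> \<exists>a b. 0 \<le> a \<and> a < t \<and> t < b \<and> b \<le> 1 \<and> C1_curve \<A> a b \<gamma>"
    using assms(2) by (rule piecewise_C1_curve_regular_points) blast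
  have "speed \<A> g \<gamma> t = speed \<A> g (f \<circ> \<gamma>) t" if t: "t \<in> {0..1} - S" for t
  proof -
    obtain a b where "C1_curve \<A> a b \<gamma>" "t \<in> {a<..<b}"
      using S(2)[OF t] by auto
    then show ?thesis
      using speed_isometry[OF f] by simp
  qed
  then show ?thesis
    unfolding curve_length_def using S(1) by (intro integral_spike[of S]) auto
qed

text \<open>The chart chosen by \<open>speed\<close> depends only on the point of the manifold, so
  it is the same on both sides. The velocity is multiplied by \<open>m\<close>, its squared length
  by the square of \<open>m\<close>.\<close>

lemma speed_affine:
  assumes \<gamma>: "C1_curve \<A> a b \<gamma>" and t: "m * t + c \<in> {a<..<b}"
  shows "speed \<A> g (\<gamma> \<circ> (\<lambda>t. m * t + c)) t = \<bar>m\<bar> * speed \<A> g \<gamma> (m * t + c)"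
proof -
  let ?r = "\<lambda>t. m * t + c"
  obtain U \<phi> where chart: "chart_at (\<gamma> (?r t)) = (U, \<phi>)" by fastforce
  then have c: "(U, \<phi>) \<in> \<A>" "\<gamma> (?r t) \<in> U"
    using chart_at[of "\<gamma> (?r t)"] by auto
  have "at (?r t) within {a..b} = at (?r t)"
    using t by (intro at_within_Icc_at) auto
  then obtain w where w: "((\<phi> \<circ> \<gamma>) has_vector_derivative w) (at (?r t))"
    using C1_curve_has_vector_derivative[OF \<gamma> _ c(1), of "?r t"] c(2) t by force
  have "(?r has_vector_derivative m) (at t)"
    by (auto intro!: derivative_eq_intros simp: has_real_derivative_iff_has_vector_derivative[symmetric])
  then have "((\<phi> \<circ> \<gamma> \<circ> ?r) has_vector_derivative m *\<^sub>R w) (at t)"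
    using w by (rule vector_diff_chain_at)
  then have v: "vector_derivative (\<phi> \<circ> (\<gamma> \<circ> ?r)) (at t) = m *\<^sub>R w" "vector_derivative (\<phi> \<circ> \<gamma>) (at (?r t)) = w"
    using w by (simp_all add: vector_derivative_at o_assoc)
  have "g (U, \<phi>) (\<phi> (\<gamma> (?r t))) (m *\<^sub>R w) (m *\<^sub>R w) = m\<^sup>2 * g (U, \<phi>) (\<phi> (\<gamma> (?r t))) w w"
    using metric_bilinear[OF c(1), of "\<phi> (\<gamma> (?r t))"] c(2)
    by (simp add: bilinear_lmul bilinear_rmul power2_eq_square)
  then show ?thesis
    using v chart by (simp add: speed_eq speed_within_def Let_def real_sqrt_mult)
qed

lemma speed_cong:
  assumes "\<forall>\<^sub>F s in nhds t. \<gamma> s = \<delta> s"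
  shows "speed \<A> g \<gamma> t = speed \<A> g \<delta> t"
proof -
  have "\<gamma> t = \<delta> t"
    using assms by (rule eventually_nhds_x_imp_x)
  moreover have "vector_derivative (snd (chart_at (\<gamma> t)) \<circ> \<gamma>) (at t) =
      vector_derivative (snd (chart_at (\<gamma> t)) \<circ> \<delta>) (at t)"
    by (rule vector_derivative_cong_eq) (use assms in \<open>auto elim: eventually_mono\<close>)
  ultimately show ?thesis
    by (simp add: speed_eq speed_within_def)
qed

lemma piecewise_C1_curve_reverse:
  assumes "piecewise_C1_curve \<A> \<gamma>"
  shows "piecewise_C1_curve \<A> (\<gamma> \<circ> (\<lambda>t. - 1 * t + 1))"
    and "curve_length \<A> g (\<gamma> \<circ> (\<lambda>t. - 1 * t + 1)) = curve_length \<A> g \<gamma>"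
proof -
  let ?r = "\<lambda>t::real. - 1 * t + 1"
  obtain S where S: "finite S" "continuous_on {0..1} \<gamma>"
    "\<And>a b. 0 \<le> a \<Longrightarrow> a < b \<Longrightarrow> b \<le> 1 \<Longrightarrow> {a<..<b} \<inter> S = {} \<Longrightarrow> C1_curve \<A> a b \<gamma>"
    using assms by (rule piecewise_C1_curveE) blast
  show "piecewise_C1_curve \<A> (\<gamma> \<circ> ?r)"
    unfolding piecewise_C1_curve_def
  proof (intro conjI exI allI impI)
    show "continuous_on {0..1} (\<gamma> \<circ> ?r)"
      by (intro continuous_on_compose continuous_intros continuous_on_subset[OF S(2)]) auto
    show "finite (?r ` S)"
      using S(1) by simp
    fix a b :: real assume ab: "0 \<le> a \<and> a < b \<and> b \<le> 1 \<and> {a<..<b} \<inter> ?r ` S = {}"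
    have "C1_curve \<A> (1 - b) (1 - a) \<gamma>"
    proof (rule S(3))
      show "{1 - b<..<1 - a} \<inter> S = {}"
      proof (rule equals0I)
        fix s assume "s \<in> {1 - b<..<1 - a} \<inter> S"
        then have "?r s \<in> {a<..<b} \<inter> ?r ` S" by auto
        with ab show False by auto
      qed
    qed (use ab in auto)
    then show "C1_curve \<A> a b (\<gamma> \<circ> ?r)"
      by (rule C1_curve_affine[OF _ refl]) auto
  qed
  obtain T where T: "finite T"
    "\<And>t. t \<in> {0..1} - T \<Longrightarrow> \<exists>a b. 0 \<le> a \<and> a < t \<and> t < b \<and> b \<le> 1 \<and> C1_curve \<A> a b \<gamma>"
    using assms by (rule piecewise_C1_curve_regular_points) blast
  \<comment> \<open>The slope is negative here, so the general substitution rule is instantiated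
    with slope -1 and shift 1. The image interval is again the unit interval.\<close>
  have "((\<lambda>t. speed \<A> g \<gamma> (- 1 *\<^sub>R t + 1)) has_integral (1 / \<bar>- 1\<bar> ^ DIM(real)) *\<^sub>R curve_length \<A> g \<gamma>)
      ((\<lambda>x. (1 / - 1) *\<^sub>R x + - ((1 / - 1) *\<^sub>R 1)) ` cbox 0 1)"
    using curve_length_has_integral[OF assms] by (intro has_integral_affinity) auto
  moreover have "(\<lambda>x::real. 1 - x) ` {0..1} = {0..1}"
    by (force simp: image_iff intro: bexI[of _ "1 - _"])
  ultimately have "((\<lambda>t. speed \<A> g \<gamma> (?r t)) has_integral curve_length \<A> g \<gamma>) {0..1}"
    by (simp add: algebra_simps)
  then have "(speed \<A> g (\<gamma> \<circ> ?r) has_integral curve_length \<A> g \<gamma>) {0..1}"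
  proof (rule has_integral_spike_finite[rotated 2])
    show "finite (?r ` T)"
      using T(1) by simp
    fix t assume t: "t \<in> {0..1} - ?r ` T"
    then have "?r t \<in> {0..1} - T"
      by (force simp: image_iff)
    then obtain a b where "C1_curve \<A> a b \<gamma>" "?r t \<in> {a<..<b}"
      using T(2)[of "?r t"] by auto
    then show "speed \<A> g (\<gamma> \<circ> ?r) t = speed \<A> g \<gamma> (?r t)"
      using speed_affine[of a b \<gamma> "-1" t 1] by simp
  qed
  then show "curve_length \<A> g (\<gamma> \<circ> ?r) = curve_length \<A> g \<gamma>"
    unfolding curve_length_def by (rule integral_unique)
qed

lemma piecewise_C1_curve_join:
  assumes \<gamma>: "piecewise_C1_curve \<A> \<gamma>" and \<delta>: "piecewise_C1_curve \<A> \<delta>" and eq: "\<gamma> 1 = \<delta> 0"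
  shows "piecewise_C1_curve \<A> (\<gamma> +++ \<delta>)"
    and "curve_length \<A> g (\<gamma> +++ \<delta>) = curve_length \<A> g \<gamma> + curve_length \<A> g \<delta>"
proof -
  obtain S where S: "finite S" "continuous_on {0..1} \<gamma>"
    "\<And>a b. 0 \<le> a \<Longrightarrow> a < b \<Longrightarrow> b \<le> 1 \<Longrightarrow> {a<..<b} \<inter> S = {} \<Longrightarrow> C1_curve \<A> a b \<gamma>"
    using \<gamma> by (rule piecewise_C1_curveE) blast
  obtain T where T: "finite T" "continuous_on {0..1} \<delta>"
    "\<And>a b. 0 \<le> a \<Longrightarrow> a < b \<Longrightarrow> b \<le> 1 \<Longrightarrow> {a<..<b} \<inter> T = {} \<Longrightarrow> C1_curve \<A> a b \<delta>"
    using \<delta> by (rule piecewise_C1_curveE) blast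
  \<comment> \<open>The break points of both curves, rescaled to their halves, together with the
    junction.\<close>
  let ?R = "insert (1/2) ((\<lambda>s. s / 2) ` S \<union> (\<lambda>s. (s + 1) / 2) ` T)"
  show "piecewise_C1_curve \<A> (\<gamma> +++ \<delta>)"
    unfolding piecewise_C1_curve_def
  proof (intro conjI exI allI impI)
    have "path (\<gamma> +++ \<delta>)"
      using S(2) T(2) eq by (intro path_join_imp) (auto simp: path_def pathfinish_def pathstart_def)
    then show "continuous_on {0..1} (\<gamma> +++ \<delta>)"
      by (simp add: path_def)
    show "finite ?R"
      using S(1) T(1) by simp
    fix a b :: real assume ab: "0 \<le> a \<and> a < b \<and> b \<le> 1 \<and> {a<..<b} \<inter> ?R = {}"
    then consider "b \<le> 1/2" | "1/2 \<le> a" by fastforce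
    then show "C1_curve \<A> a b (\<gamma> +++ \<delta>)"
    proof cases
      case 1
      have "C1_curve \<A> (2 * a) (2 * b) \<gamma>"
      proof (rule S(3))
        show "{2 * a<..<2 * b} \<inter> S = {}"
        proof (rule equals0I)
          fix s assume "s \<in> {2 * a<..<2 * b} \<inter> S"
          then have "s / 2 \<in> {a<..<b} \<inter> ?R" by auto
          with ab show False by auto
        qed
      qed (use ab 1 in auto)
      then have "C1_curve \<A> a b (\<gamma> \<circ> (\<lambda>t. 2 * t + 0))"
        by (rule C1_curve_affine[OF _ refl]) auto
      then show ?thesis
        by (rule C1_curve_cong) (use 1 in \<open>auto simp: joinpaths_def\<close>)
    next
      case 2
      have "C1_curve \<A> (2 * a - 1) (2 * b - 1) \<delta>"
      proof (rule T(3))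
        show "{2 * a - 1<..<2 * b - 1} \<inter> T = {}"
        proof (rule equals0I)
          fix s assume "s \<in> {2 * a - 1<..<2 * b - 1} \<inter> T"
          then have "(s + 1) / 2 \<in> {a<..<b} \<inter> ?R" by auto
          with ab show False by auto
        qed
      qed (use ab 2 in auto)
      then have "C1_curve \<A> a b (\<delta> \<circ> (\<lambda>t. 2 * t + - 1))"
        by (rule C1_curve_affine[OF _ refl]) auto
      then show ?thesis
      proof (rule C1_curve_cong)
        fix t assume "t \<in> {a..b}"
        then show "(\<delta> \<circ> (\<lambda>t. 2 * t + - 1)) t = (\<gamma> +++ \<delta>) t"
        proof (cases "t = 1/2")
          \<comment> \<open>At 1/2 the concatenation is defined by its first branch, and the common
            end point makes the second branch agree.\<close>
          case True
          show ?thesis unfolding True using eq by (simp add: joinpaths_def)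
        qed (use 2 in \<open>auto simp: joinpaths_def\<close>)
      qed
    qed
  qed
  obtain S' where S': "finite S'"
    "\<And>t. t \<in> {0..1} - S' \<Longrightarrow> \<exists>a b. 0 \<le> a \<and> a < t \<and> t < b \<and> b \<le> 1 \<and> C1_curve \<A> a b \<gamma>"
    using \<gamma> by (rule piecewise_C1_curve_regular_points) blast
  obtain T' where T': "finite T'"
    "\<And>t. t \<in> {0..1} - T' \<Longrightarrow> \<exists>a b. 0 \<le> a \<and> a < t \<and> t < b \<and> b \<le> 1 \<and> C1_curve \<A> a b \<delta>"
    using \<delta> by (rule piecewise_C1_curve_regular_points) blast
  \<comment> \<open>The Jacobian 2 of the substitution is the factor by which the speed
    grows.\<close>
  have "((\<lambda>t. 2 *\<^sub>R speed \<A> g \<gamma> (2 * t + 0)) has_integral curve_length \<A> g \<gamma>) {0..1/2}"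
    using curve_length_has_integral[OF \<gamma>] by (intro has_integral_affinity_interval) auto
  then have "(speed \<A> g (\<gamma> +++ \<delta>) has_integral curve_length \<A> g \<gamma>) {0..1/2}"
  proof (rule has_integral_spike_finite[rotated 2])
    show "finite (insert (1/2) ((\<lambda>s. s / 2) ` S'))"
      using S'(1) by simp
    fix t :: real assume t: "t \<in> {0..1/2} - insert (1/2) ((\<lambda>s. s / 2) ` S')"
    then have "2 * t + 0 \<in> {0..1} - S'"
      using imageI[of "2 * t" S' "\<lambda>s. s / 2"] by auto
    then obtain a b where ab: "C1_curve \<A> a b \<gamma>" "2 * t + 0 \<in> {a<..<b}"
      using S'(2)[of "2 * t + 0"] by auto
    have "\<forall>\<^sub>F s in nhds t. s \<in> {..<1/2}"
      using t by (intro eventually_nhds_in_open) auto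
    then have "\<forall>\<^sub>F s in nhds t. (\<gamma> +++ \<delta>) s = (\<gamma> \<circ> (\<lambda>t. 2 * t + 0)) s"
      by eventually_elim (simp add: joinpaths_def)
    then have "speed \<A> g (\<gamma> +++ \<delta>) t = speed \<A> g (\<gamma> \<circ> (\<lambda>t. 2 * t + 0)) t"
      by (rule speed_cong)
    also have "\<dots> = 2 *\<^sub>R speed \<A> g \<gamma> (2 * t + 0)"
      using speed_affine[OF ab] by simp
    finally show "speed \<A> g (\<gamma> +++ \<delta>) t = 2 *\<^sub>R speed \<A> g \<gamma> (2 * t + 0)" .
  qed
  moreover
  have "((\<lambda>t. 2 *\<^sub>R speed \<A> g \<delta> (2 * t + - 1)) has_integral curve_length \<A> g \<delta>) {1/2..1}"
    using curve_length_has_integral[OF \<delta>] by (intro has_integral_affinity_interval) auto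
  then have "(speed \<A> g (\<gamma> +++ \<delta>) has_integral curve_length \<A> g \<delta>) {1/2..1}"
  proof (rule has_integral_spike_finite[rotated 2])
    show "finite (insert (1/2) ((\<lambda>s. (s + 1) / 2) ` T'))"
      using T'(1) by simp
    fix t :: real assume t: "t \<in> {1/2..1} - insert (1/2) ((\<lambda>s. (s + 1) / 2) ` T')"
    then have "2 * t + - 1 \<in> {0..1} - T'"
      using imageI[of "2 * t + - 1" T' "\<lambda>s. (s + 1) / 2"] by auto
    then obtain a b where ab: "C1_curve \<A> a b \<delta>" "2 * t + - 1 \<in> {a<..<b}"
      using T'(2)[of "2 * t + - 1"] by auto
    have "\<forall>\<^sub>F s in nhds t. s \<in> {1/2<..}"
      using t by (intro eventually_nhds_in_open) auto
    then have "\<forall>\<^sub>F s in nhds t. (\<gamma> +++ \<delta>) s = (\<delta> \<circ> (\<lambda>t. 2 * t + - 1)) s"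
      by eventually_elim (simp add: joinpaths_def)
    then have "speed \<A> g (\<gamma> +++ \<delta>) t = speed \<A> g (\<delta> \<circ> (\<lambda>t. 2 * t + - 1)) t"
      by (rule speed_cong)
    also have "\<dots> = 2 *\<^sub>R speed \<A> g \<delta> (2 * t + - 1)"
      using speed_affine[OF ab] by simp
    finally show "speed \<A> g (\<gamma> +++ \<delta>) t = 2 *\<^sub>R speed \<A> g \<delta> (2 * t + - 1)" .
  qed
  ultimately have "(speed \<A> g (\<gamma> +++ \<delta>) has_integral curve_length \<A> g \<gamma> + curve_length \<A> g \<delta>) {0..1}"
    by (intro has_integral_combine[of 0 "1/2" 1]) auto
  then show "curve_length \<A> g (\<gamma> +++ \<delta>) = curve_length \<A> g \<gamma> + curve_length \<A> g \<delta>"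
    unfolding curve_length_def[of _ _ "\<gamma> +++ \<delta>"] by (rule integral_unique)
qed

text \<open>In a chart around \<open>x\<close> the squared length of a vector is jointly continuous
  in base point and vector, and vanishes for the zero vector. It is thus small for base points near
  \<open>\<phi> x\<close> and short vectors, and the preimage of the straight segment from
  \<open>\<phi> x\<close> to \<open>\<phi> y\<close> is a short curve.\<close>

lemma short_curves:
  assumes "0 < \<epsilon>"
  obtains W where "open W" "x \<in> W"
    "\<And>y. y \<in> W \<Longrightarrow> \<exists>\<gamma>. piecewise_C1_curve \<A> \<gamma> \<and> \<gamma> 0 = x \<and> \<gamma> 1 = y \<and> curve_length \<A> g \<gamma> < \<epsilon>"
proof -
  obtain U \<phi> where c: "(U, \<phi>) \<in> \<A>" and x: "x \<in> U" by (rule ex_chart)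
  let ?p = "\<phi> x"
  let ?G = "\<lambda>z. g (U, \<phi>) (fst z) (snd z) (snd z)"
  have "continuous_on (\<phi> ` U \<times> UNIV) ?G"
    by (rule metric_continuous[OF c]) (auto intro!: continuous_intros)
  moreover have opn: "open (\<phi> ` U \<times> (UNIV :: 'e set))"
    using chart_image_open[OF c] by (intro open_Times) auto
  \<comment> \<open>The square compensates the root in the speed. Halving \<open>\<epsilon>\<close>
    leaves room, since integration only yields a nonstrict bound on the length.\<close>
  ultimately have "open (?G -` {..<(\<epsilon>/2)\<^sup>2} \<inter> \<phi> ` U \<times> UNIV)"
    by (simp add: continuous_on_open_vimage)
  moreover have "?G (?p, 0) = 0"
    using metric_bilinear[OF c, of ?p] x by (auto simp: bilinear_lzero)
  then have "(?p, 0) \<in> ?G -` {..<(\<epsilon>/2)\<^sup>2} \<inter> \<phi> ` U \<times> UNIV"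
    using x assms by auto
  ultimately obtain A B where AB: "open A" "open B" "?p \<in> A" "0 \<in> B"
      "A \<times> B \<subseteq> ?G -` {..<(\<epsilon>/2)\<^sup>2} \<inter> \<phi> ` U \<times> UNIV"
    by (rule open_prod_elim) auto
  obtain d1 d2 where d12: "d1 > 0" "ball ?p d1 \<subseteq> A" "d2 > 0" "ball 0 d2 \<subseteq> B"
    using AB(1-4) by (metis open_contains_ball)
  define d where "d = min d1 d2"
  have d: "d > 0" "ball ?p d \<subseteq> A" "ball 0 d \<subseteq> B"
    using d12 by (auto simp: d_def)
  have G: "q \<in> \<phi> ` U \<and> g (U, \<phi>) q w w < (\<epsilon>/2)\<^sup>2" if "q \<in> ball ?p d" "w \<in> ball 0 d" for q w
  proof -
    have "(q, w) \<in> A \<times> B" using that d by auto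
    then show ?thesis using AB(5) by auto
  qed
  let ?W = "\<phi> -` ball ?p d \<inter> U"
  show ?thesis
  proof (rule that)
    show "open ?W"
      using chart_continuous_on[OF c] chart_open[OF c] continuous_on_open_vimage open_ball by blast
    show "x \<in> ?W"
      using x d by auto
    fix y assume y: "y \<in> ?W"
    let ?w = "\<phi> y - ?p"
    let ?\<gamma> = "\<lambda>t. inv_into U \<phi> (?p + t *\<^sub>R ?w)"
    have w: "norm ?w < d"
      using y by (simp add: dist_norm norm_minus_commute)
    have line: "?p + t *\<^sub>R ?w \<in> ball ?p d" if "t \<in> {0..1}" for t
    proof -
      have "norm (t *\<^sub>R ?w) \<le> norm ?w"
        using that by (simp add: mult_left_le_one_le)
      with w show ?thesis by (simp add: dist_norm)
    qed
    \<comment> \<open>The zero vector is an admissible second argument of \<open>G\<close>; only the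
      membership in the chart image is taken from it.\<close>
    have lineU: "?p + t *\<^sub>R ?w \<in> \<phi> ` U" if "t \<in> {0..1}" for t
      using G[OF line[OF that], of 0] d(1) by simp
    have \<gamma>U: "?\<gamma> t \<in> U" "\<phi> (?\<gamma> t) = ?p + t *\<^sub>R ?w" if "t \<in> {0..1}" for t
      using lineU[OF that] by (auto intro: inv_into_into f_inv_into_f)
    have cont: "continuous_on {0..1} ?\<gamma>"
      by (rule continuous_on_compose2[OF homeomorphism_cont2[OF chart_homeomorphism[OF c]]])
        (use lineU in \<open>auto intro!: continuous_intros\<close>)
    have deriv: "((\<phi> \<circ> ?\<gamma>) has_vector_derivative ?w) (at t within {0..1})" if "t \<in> {0..1}" for t
    proof (rule has_vector_derivative_transform[OF that])
      show "((\<lambda>t. ?p + t *\<^sub>R ?w) has_vector_derivative ?w) (at t within {0..1})"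
        by (auto intro!: derivative_eq_intros)
    qed (use \<gamma>U in auto)
    \<comment> \<open>Composition with \<open>id\<close> allows the single-chart criterion to be
      applied.\<close>
    have "C1_curve \<A> 0 1 (id \<circ> ?\<gamma>)"
    proof (rule C1_curve_smooth_map[OF smooth_map_id _ cont])
      fix t :: real assume "t \<in> {0..1}"
      with c \<gamma>U deriv show "\<exists>U \<phi> w. (U, \<phi>) \<in> \<A> \<and> ?\<gamma> t \<in> U \<and> continuous_on ({0..1} \<inter> ?\<gamma> -` U) w \<and>
          (\<forall>s\<in>{0..1} \<inter> ?\<gamma> -` U. ((\<phi> \<circ> ?\<gamma>) has_vector_derivative w s) (at s within {0..1}))"
        by (intro exI[of _ U] exI[of _ \<phi>] exI[of _ "\<lambda>_. ?w"]) auto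
    qed simp
    then have C1: "C1_curve \<A> 0 1 ?\<gamma>"
      by simp
    then have pw: "piecewise_C1_curve \<A> ?\<gamma>"
      unfolding piecewise_C1_curve_def using cont C1_curve_subset[OF C1] by (intro conjI exI[of _ "{}"]) auto
    have "\<bar>speed \<A> g ?\<gamma> t\<bar> \<le> \<epsilon>/2" if t: "t \<in> {0<..<1}" for t
    proof -
      have t': "t \<in> {0..1}" using t by simp
      have "vector_derivative (\<phi> \<circ> ?\<gamma>) (at t within {0..1}) = ?w"
        using deriv[OF t'] t' by (intro vector_derivative_within_closed_interval) auto
      then have "speed \<A> g ?\<gamma> t = sqrt (g (U, \<phi>) (?p + t *\<^sub>R ?w) ?w ?w)"
        using speed_interior[OF C1 t c] \<gamma>U[OF t'] by (simp add: speed_within_def Let_def)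
      also have "\<dots> \<le> sqrt ((\<epsilon>/2)\<^sup>2)"
        using G[OF line[OF t'], of ?w] w by (intro real_sqrt_le_mono) (simp add: less_imp_le)
      also have "\<dots> = \<epsilon>/2"
        using assms by simp
      finally show ?thesis
        using speed_nonneg_C1[OF C1 t] by simp
    qed
    then have "norm (curve_length \<A> g ?\<gamma>) \<le> \<epsilon>/2 * measure lborel (cbox 0 (1::real))"
      using assms curve_length_has_integral[OF pw]
      by (intro has_integral_bound_spike_finite[of "\<epsilon>/2" "{0, 1}" "speed \<A> g ?\<gamma>"]) auto
    then have "curve_length \<A> g ?\<gamma> < \<epsilon>"
      using assms by simp
    moreover have "?\<gamma> 0 = x" "?\<gamma> 1 = y"
      using x y by (auto simp: chart_inv[OF c])
    ultimately show "\<exists>\<gamma>. piecewise_C1_curve \<A> \<gamma> \<and> \<gamma> 0 = x \<and> \<gamma> 1 = y \<and> curve_length \<A> g \<gamma> < \<epsilon>"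
      using pw by blast
  qed
qed

text \<open>This becomes the relation "distance less than \<open>c\<close>". It is studied before
  the infimum, because \<open>Inf\<close> carries information only once some curve is known to join
  the points.\<close>

definition joined :: "real \<Rightarrow> 'a \<Rightarrow> 'a \<Rightarrow> bool" where
  "joined c x y \<longleftrightarrow> (\<exists>\<gamma>. piecewise_C1_curve \<A> \<gamma> \<and> \<gamma> 0 = x \<and> \<gamma> 1 = y \<and> curve_length \<A> g \<gamma> < c)"

lemma joined_sym:
  assumes "joined c x y"
  shows "joined c y x"
proof -
  obtain \<gamma> where \<gamma>: "piecewise_C1_curve \<A> \<gamma>" "\<gamma> 0 = x" "\<gamma> 1 = y" "curve_length \<A> g \<gamma> < c"
    using assms unfolding joined_def by blast
  then show ?thesis
    unfolding joined_def using piecewise_C1_curve_reverse[OF \<gamma>(1)]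
    by (intro exI[of _ "\<gamma> \<circ> (\<lambda>t. - 1 * t + 1)"]) auto
qed

lemma joined_trans:
  assumes "joined c x y" "joined d y z"
  shows "joined (c + d) x z"
proof -
  obtain \<gamma> where \<gamma>: "piecewise_C1_curve \<A> \<gamma>" "\<gamma> 0 = x" "\<gamma> 1 = y" "curve_length \<A> g \<gamma> < c"
    using assms(1) unfolding joined_def by blast
  obtain \<delta> where \<delta>: "piecewise_C1_curve \<A> \<delta>" "\<delta> 0 = y" "\<delta> 1 = z" "curve_length \<A> g \<delta> < d"
    using assms(2) unfolding joined_def by blast
  have "\<gamma> 1 = \<delta> 0" using \<gamma> \<delta> by simp
  from piecewise_C1_curve_join[OF \<gamma>(1) \<delta>(1) this] \<gamma> \<delta> show ?thesis
    unfolding joined_def by (intro exI[of _ "\<gamma> +++ \<delta>"]) (auto simp: joinpaths_def)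
qed

lemma joined_nhd:
  assumes "0 < \<epsilon>"
  obtains W where "open W" "x \<in> W" "\<And>y. y \<in> W \<Longrightarrow> joined \<epsilon> x y"
  by (rule short_curves[OF assms, of x]) (simp add: joined_def)

text \<open>The points reachable from \<open>x\<close> form an open set by appending short curves.
  The unreachable ones do so as well, since a short curve can be run backwards. Connectedness leaves
  no room for the latter.\<close>

lemma ex_joined: "\<exists>c. joined c x y"
proof -
  let ?T = "{y. \<exists>c. joined c x y}"
  have "open ?T"
  proof (subst open_subopen, rule ballI)
    fix y assume "y \<in> ?T"
    then obtain c where y: "joined c x y" by blast
    obtain W where W: "open W" "y \<in> W" "\<And>z. z \<in> W \<Longrightarrow> joined 1 y z"
      by (rule joined_nhd[of 1 y]) auto
    then show "\<exists>W. open W \<and> y \<in> W \<and> W \<subseteq> ?T"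
      using joined_trans[OF y] by blast
  qed
  moreover have "open (- ?T)"
  proof (subst open_subopen, rule ballI)
    fix y assume y: "y \<in> - ?T"
    obtain W where W: "open W" "y \<in> W" "\<And>z. z \<in> W \<Longrightarrow> joined 1 y z"
      by (rule joined_nhd[of 1 y]) auto
    have "W \<subseteq> - ?T"
      using W(3) joined_sym joined_trans y by blast
    then show "\<exists>W. open W \<and> y \<in> W \<and> W \<subseteq> - ?T"
      using W by blast
  qed
  moreover have "x \<in> ?T"
    using joined_nhd[of 1 x] by auto
  ultimately have "?T = UNIV"
    using connectedD[of UNIV ?T "- ?T"] manifold unfolding riemannian_manifold_def by auto
  then show ?thesis by blast
qed

text \<open>The set of lengths is nonempty by connectedness and bounded below by 0, so its real
  infimum is genuine.\<close>

lemma geodesic_dist_less_iff: "geodesic_dist \<A> g x y < c \<longleftrightarrow> joined c x y"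
proof -
  let ?L = "{curve_length \<A> g \<gamma> | \<gamma>. piecewise_C1_curve \<A> \<gamma> \<and> \<gamma> 0 = x \<and> \<gamma> 1 = y}"
  have "?L \<noteq> {}"
    using ex_joined[of x y] unfolding joined_def by blast
  moreover have "bdd_below ?L"
    using curve_length_nonneg by (intro bdd_belowI[of _ 0]) auto
  ultimately show ?thesis
    unfolding geodesic_dist_def joined_def by (subst cInf_less_iff) blast+
qed

lemma geodesic_dist_nonneg: "0 \<le> geodesic_dist \<A> g x y"
proof (rule ccontr)
  assume "\<not> ?thesis"
  then have "joined 0 x y"
    using geodesic_dist_less_iff[of x y 0] by simp
  then show False
    unfolding joined_def using curve_length_nonneg by fastforce
qed

lemma geodesic_dist_eqI:
  assumes "\<And>c. joined c x y \<longleftrightarrow> joined c x' y'"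
  shows "geodesic_dist \<A> g x y = geodesic_dist \<A> g x' y'"
proof (rule antisym)
  show "geodesic_dist \<A> g x y \<le> geodesic_dist \<A> g x' y'"
    using assms geodesic_dist_less_iff[of x y "geodesic_dist \<A> g x y"]
      geodesic_dist_less_iff[of x' y' "geodesic_dist \<A> g x y"] by simp
  show "geodesic_dist \<A> g x' y' \<le> geodesic_dist \<A> g x y"
    using assms geodesic_dist_less_iff[of x y "geodesic_dist \<A> g x' y'"]
      geodesic_dist_less_iff[of x' y' "geodesic_dist \<A> g x' y'"] by simp
qed

lemma geodesic_dist_commute: "geodesic_dist \<A> g x y = geodesic_dist \<A> g y x"
  by (rule geodesic_dist_eqI) (use joined_sym in blast)

lemma geodesic_dist_isometry:
  assumes f: "isometry \<A> g f"
  shows "geodesic_dist \<A> g (f x) (f y) = geodesic_dist \<A> g x y"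
proof -
  have smooth: "smooth_map \<A> f" "smooth_map \<A> (inv f)" and bij: "bij f"
    using f by (auto simp: isometry_def)
  have "joined c (f x) (f y)" if H: "joined c x y" for c
  proof -
    obtain \<gamma> where \<gamma>: "piecewise_C1_curve \<A> \<gamma>" "\<gamma> 0 = x" "\<gamma> 1 = y" "curve_length \<A> g \<gamma> < c"
      using H unfolding joined_def by blast
    then show ?thesis
      unfolding joined_def using piecewise_C1_curve_comp[OF smooth(1)] curve_length_isometry[OF f \<gamma>(1)]
      by (intro exI[of _ "f \<circ> \<gamma>"]) auto
  qed
  moreover have "joined c x y" if H: "joined c (f x) (f y)" for c
  proof -
    obtain \<gamma> where \<gamma>: "piecewise_C1_curve \<A> \<gamma>" "\<gamma> 0 = f x" "\<gamma> 1 = f y" "curve_length \<A> g \<gamma> < c"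
      using H unfolding joined_def by blast
    \<comment> \<open>Invariance of length under \<open>f\<close> is applied to the pulled-back
      curve, whose image is \<open>\<gamma>\<close>; of the inverse map only smoothness
      enters.\<close>
    have pw: "piecewise_C1_curve \<A> (inv f \<circ> \<gamma>)"
      using piecewise_C1_curve_comp[OF smooth(2) \<gamma>(1)] .
    moreover have "f \<circ> (inv f \<circ> \<gamma>) = \<gamma>"
      using bij by (simp add: fun_eq_iff bij_is_surj surj_f_inv_f)
    then have "curve_length \<A> g (inv f \<circ> \<gamma>) = curve_length \<A> g \<gamma>"
      using curve_length_isometry[OF f pw] by simp
    moreover have "inv f (f z) = z" for z
      using bij by (simp add: bij_is_inj)
    ultimately show ?thesis
      unfolding joined_def using \<gamma> by (intro exI[of _ "inv f \<circ> \<gamma>"]) auto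
  qed
  ultimately show ?thesis
    by (intro geodesic_dist_eqI iffI)
qed

text \<open>Upper semicontinuity: with \<open>d\<close> strictly between the distance and
  \<open>c\<close>, moving each end point by less than half of \<open>c - d\<close> keeps the
  distance below \<open>c\<close>.\<close>

lemma open_geodesic_dist_less: "open {z. geodesic_dist \<A> g (fst z) (snd z) < c}"
proof (subst open_subopen, clarify)
  fix x y assume "geodesic_dist \<A> g (fst (x, y)) (snd (x, y)) < c"
  then obtain d where d: "geodesic_dist \<A> g x y < d" "d < c"
    using dense by auto
  have "0 < (c - d) / 2" using d by simp
  then obtain W V where W: "open W" "x \<in> W" "\<And>z. z \<in> W \<Longrightarrow> joined ((c - d) / 2) x z"
      and V: "open V" "y \<in> V" "\<And>z. z \<in> V \<Longrightarrow> joined ((c - d) / 2) y z"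
    using joined_nhd by metis
  have "geodesic_dist \<A> g x' y' < c" if "x' \<in> W" "y' \<in> V" for x' y'
  proof -
    have "joined ((c - d) / 2 + d + (c - d) / 2) x' y'"
      using W(3) V(3) that d(1) joined_sym joined_trans geodesic_dist_less_iff by meson
    then show ?thesis
      by (simp add: geodesic_dist_less_iff field_simps)
  qed
  then show "\<exists>T. open T \<and> (x, y) \<in> T \<and> T \<subseteq> {z. geodesic_dist \<A> g (fst z) (snd z) < c}"
    using W V by (intro exI[of _ "W \<times> V"]) (auto intro: open_Times)
qed

text \<open>By second countability the product sigma-algebra is the Borel sigma-algebra of the
  product space, so open strict sublevel sets are enough.\<close>

lemma borel_measurable_geodesic_dist:
  "(\<lambda>z. geodesic_dist \<A> g (fst z) (snd z)) \<in> borel_measurable (borel \<Otimes>\<^sub>M borel)"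
  unfolding borel_prod borel_measurable_iff_less
  using open_geodesic_dist_less by auto

end


section \<open>Poisson weights and \<open>L\<^sup>1\<close> series\<close>

text \<open>A convex power lies above its tangents. In the induction, \<open>s\<close> times the
  tangent of degree n + 1 exceeds the tangent of degree n + 2 by a multiple of a square.\<close>

lemma power_tangent_le:
  fixes s t :: real
  assumes "0 \<le> s" "0 \<le> t"
  shows "t ^ Suc n + (s - t) * (real (Suc n) * t ^ n) \<le> s ^ Suc n"
proof (induction n)
  case (Suc n)
  have "s * (t ^ Suc n + (s - t) * (real (Suc n) * t ^ n)) -
      (t ^ Suc (Suc n) + (s - t) * (real (Suc (Suc n)) * t ^ Suc n)) = real (Suc n) * t ^ n * (s - t)\<^sup>2"
    by (simp add: algebra_simps power2_eq_square)
  moreover have "0 \<le> real (Suc n) * t ^ n * (s - t)\<^sup>2"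
    using assms by simp
  ultimately have "t ^ Suc (Suc n) + (s - t) * (real (Suc (Suc n)) * t ^ Suc n) \<le>
      s * (t ^ Suc n + (s - t) * (real (Suc n) * t ^ n))"
    by linarith
  also have "\<dots> \<le> s * s ^ Suc n"
    using Suc assms by (intro mult_left_mono)
  finally show ?case by simp
qed simp

definition exp_term :: "real \<Rightarrow> nat \<Rightarrow> real" where
  "exp_term t n = t ^ n / fact n"

definition exp_term_deriv :: "real \<Rightarrow> nat \<Rightarrow> real" where
  "exp_term_deriv t n = (case n of 0 \<Rightarrow> 0 | Suc k \<Rightarrow> exp_term t k)"

lemma exp_term_sums: "exp_term t sums exp t"
  using exp_converges[of t] by (simp add: exp_term_def[abs_def] scaleR_conv_of_real divide_inverse mult.commute)

lemma exp_term_deriv_sums: "exp_term_deriv t sums exp t"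
  by (rule sums_Suc_imp) (simp_all add: exp_term_deriv_def exp_term_sums)

lemma exp_term_nonneg: "0 \<le> t \<Longrightarrow> 0 \<le> exp_term t n"
  and exp_term_deriv_nonneg: "0 \<le> t \<Longrightarrow> 0 \<le> exp_term_deriv t n"
  by (auto simp: exp_term_deriv_def exp_term_def split: nat.split)

text \<open>The sign is what matters: first-order remainders that are all nonnegative have an l^1
  norm equal to the remainder of their sum, which is that of the exponential function.\<close>

lemma exp_term_tangent_le:
  assumes "0 \<le> s" "0 \<le> t"
  shows "exp_term t n + (s - t) * exp_term_deriv t n \<le> exp_term s n"
proof (cases n)
  case (Suc k)
  have "exp_term t k = real (Suc k) * t ^ k / fact n"
    by (simp add: exp_term_def Suc del: of_nat_Suc)
  then have "exp_term t n + (s - t) * exp_term_deriv t n = (t ^ Suc k + (s - t) * (real (Suc k) * t ^ k)) / fact n"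
    by (simp add: Suc exp_term_def[of t "Suc k"] exp_term_deriv_def add_divide_distrib)
  also have "\<dots> \<le> s ^ Suc k / fact n"
    using power_tangent_le[OF assms] by (intro divide_right_mono) auto
  finally show ?thesis by (simp add: Suc exp_term_def)
qed (simp add: exp_term_def exp_term_deriv_def)

definition poisson :: "real \<Rightarrow> nat \<Rightarrow> real" where
  "poisson t n = exp (- t) * exp_term t n"

text \<open>The derivative of \<open>poisson t n\<close> in \<open>t\<close>, that is, the weight at
  n - 1 minus the weight at n, with weight 0 at index -1.\<close>

definition poisson_deriv :: "real \<Rightarrow> nat \<Rightarrow> real" where
  "poisson_deriv t n = exp (- t) * (exp_term_deriv t n - exp_term t n)"

lemma poisson_sums: "poisson t sums 1"
  using sums_mult[OF exp_term_sums, of "exp (- t)" t] by (simp add: poisson_def[abs_def] exp_minus)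

lemma poisson_nonneg: "0 \<le> t \<Longrightarrow> 0 \<le> poisson t n"
  by (simp add: poisson_def exp_term_nonneg)

text \<open>The product rule for exp(-t) times \<open>exp_term\<close> leaves three errors: that of
  the quotient of \<open>exp_term\<close>, the change of the factor exp(-t), and that of the
  quotient of exp(-t). Each is summed exactly, so the bound is an explicit scalar expression that
  tends to 0 with \<open>h\<close>.\<close>

lemma sum_poisson_difference_quotient:
  assumes "0 \<le> t" "0 \<le> t + h" "h \<noteq> 0"
  defines "c \<equiv> \<lambda>n. (poisson (t + h) n - poisson t n) / h - poisson_deriv t n"
  shows "summable (\<lambda>n. \<bar>c n\<bar>)"
    and "(\<Sum>n. \<bar>c n\<bar>) \<le> exp (- (t + h)) * \<bar>(exp (t + h) - exp t) / h - exp t\<bar> +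
      \<bar>exp (- (t + h)) - exp (- t)\<bar> * exp t + \<bar>(exp (- (t + h)) - exp (- t)) / h + exp (- t)\<bar> * exp t"
proof -
  define b where "b n = (exp_term (t + h) n - exp_term t n) / h - exp_term_deriv t n" for n
  define B where "B n = exp (- (t + h)) * \<bar>b n\<bar> +
      \<bar>exp (- (t + h)) - exp (- t)\<bar> * exp_term_deriv t n +
      \<bar>(exp (- (t + h)) - exp (- t)) / h + exp (- t)\<bar> * exp_term t n" for n
  \<comment> \<open>\<open>W n\<close> is \<open>h\<close> times \<open>b n\<close>. All
    \<open>W n\<close> are nonnegative whatever the sign of \<open>h\<close>, so the absolute values
    of \<open>b n\<close> sum to the absolute value of their sum.\<close>
  define W where "W n = exp_term (t + h) n - exp_term t n - h * exp_term_deriv t n" for n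
  have W0: "0 \<le> W n" for n
    using exp_term_tangent_le[OF assms(2,1), of n] by (simp add: W_def)
  have Wsums: "W sums (exp (t + h) - exp t - h * exp t)"
    unfolding W_def by (intro sums_diff sums_mult exp_term_sums exp_term_deriv_sums)
  have "0 \<le> exp (t + h) - exp t - h * exp t"
    using W0 Wsums sums_le[OF _ sums_zero Wsums] by simp
  moreover have "b n = W n / h" for n
    using assms(3) by (simp add: b_def W_def field_simps)
  moreover have "(exp (t + h) - exp t) / h - exp t = (exp (t + h) - exp t - h * exp t) / h"
    using assms(3) by (simp add: field_simps)
  ultimately have "(\<lambda>n. \<bar>b n\<bar>) sums \<bar>(exp (t + h) - exp t) / h - exp t\<bar>"
    using sums_divide[OF Wsums, of "\<bar>h\<bar>"] W0 by (simp add: abs_divide)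
  then have Bsums: "B sums (exp (- (t + h)) * \<bar>(exp (t + h) - exp t) / h - exp t\<bar> +
      \<bar>exp (- (t + h)) - exp (- t)\<bar> * exp t + \<bar>(exp (- (t + h)) - exp (- t)) / h + exp (- t)\<bar> * exp t)"
    unfolding B_def by (intro sums_add sums_mult exp_term_sums exp_term_deriv_sums)
  have le: "\<bar>c n\<bar> \<le> B n" for n
  proof -
    have "c n = exp (- (t + h)) * b n + (exp (- (t + h)) - exp (- t)) * exp_term_deriv t n +
        ((exp (- (t + h)) - exp (- t)) / h + exp (- t)) * exp_term t n"
      unfolding c_def b_def poisson_def poisson_deriv_def using assms(3)
      by (simp add: field_simps)
    also have "\<bar>\<dots>\<bar> \<le> \<bar>exp (- (t + h)) * b n\<bar> + \<bar>(exp (- (t + h)) - exp (- t)) * exp_term_deriv t n\<bar> +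
        \<bar>((exp (- (t + h)) - exp (- t)) / h + exp (- t)) * exp_term t n\<bar>"
      by linarith
    also have "\<dots> = B n"
      using exp_term_nonneg[OF assms(1)] exp_term_deriv_nonneg[OF assms(1)] by (simp add: B_def abs_mult)
    finally show ?thesis .
  qed
  show c_summable: "summable (\<lambda>n. \<bar>c n\<bar>)"
    by (rule summable_comparison_test'[OF sums_summable[OF Bsums], of 0]) (simp add: le)
  show "(\<Sum>n. \<bar>c n\<bar>) \<le> exp (- (t + h)) * \<bar>(exp (t + h) - exp t) / h - exp t\<bar> +
      \<bar>exp (- (t + h)) - exp (- t)\<bar> * exp t + \<bar>(exp (- (t + h)) - exp (- t)) / h + exp (- t)\<bar> * exp t"
    unfolding sums_unique[OF Bsums] by (rule suminf_le[OF le c_summable sums_summable[OF Bsums]])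
qed

lemma sum_poisson_difference_quotient_tendsto:
  "((\<lambda>h. exp (- (t + h)) * \<bar>(exp (t + h) - exp t) / h - exp t\<bar> +
      \<bar>exp (- (t + h)) - exp (- t)\<bar> * exp t +
      \<bar>(exp (- (t + h)) - exp (- t)) / h + exp (- t)\<bar> * exp t) \<longlongrightarrow> 0) (at (0::real))"
proof -
  have "((\<lambda>h. (exp (t + h) - exp t) / h) \<longlongrightarrow> exp t) (at 0)"
    using DERIV_exp[of t] by (simp add: DERIV_def)
  moreover have "((\<lambda>s. exp (- s)) has_real_derivative - exp (- t)) (at t)"
    by (auto intro!: derivative_eq_intros)
  then have "((\<lambda>h. (exp (- (t + h)) - exp (- t)) / h) \<longlongrightarrow> - exp (- t)) (at 0)"
    by (simp add: DERIV_def)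
  ultimately have "((\<lambda>h. exp (- (t + h)) * \<bar>(exp (t + h) - exp t) / h - exp t\<bar> +
      \<bar>exp (- (t + h)) - exp (- t)\<bar> * exp t +
      \<bar>(exp (- (t + h)) - exp (- t)) / h + exp (- t)\<bar> * exp t) \<longlongrightarrow>
      exp (- (t + 0)) * \<bar>exp t - exp t\<bar> + \<bar>exp (- (t + 0)) - exp (- t)\<bar> * exp t +
      \<bar>- exp (- t) + exp (- t)\<bar> * exp t) (at 0)"
    by (intro tendsto_intros)
  then show ?thesis by simp
qed

lemma sum_poisson_difference:
  assumes "0 \<le> t" "0 \<le> r"
  shows "summable (\<lambda>n. \<bar>poisson r n - poisson t n\<bar>)"
    and "(\<Sum>n. \<bar>poisson r n - poisson t n\<bar>) \<le> exp (- r) * \<bar>exp r - exp t\<bar> + \<bar>exp (- r) - exp (- t)\<bar> * exp t"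
proof -
  define B where "B n = exp (- r) * \<bar>exp_term r n - exp_term t n\<bar> + \<bar>exp (- r) - exp (- t)\<bar> * exp_term t n" for n
  have "(\<lambda>n. \<bar>exp_term r n - exp_term t n\<bar>) sums \<bar>exp r - exp t\<bar>"
  \<comment> \<open>The terms are monotone in time, so in either case all differences have one sign
    and telescope into a difference of exponentials.\<close>
  proof (cases "t \<le> r")
    case True
    then have "exp_term t n \<le> exp_term r n" for n
      using assms by (simp add: exp_term_def divide_right_mono power_mono)
    then show ?thesis
      using sums_diff[OF exp_term_sums exp_term_sums, of r t] True by simp
  next
    case False
    then have "exp_term r n \<le> exp_term t n" for n
      using assms by (simp add: exp_term_def divide_right_mono power_mono)
    then show ?thesis
      using sums_diff[OF exp_term_sums exp_term_sums, of t r] False by (simp add: abs_minus_commute[of "_ r _"] abs_minus_commute[of "exp r"])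
  qed
  then have Bsums: "B sums (exp (- r) * \<bar>exp r - exp t\<bar> + \<bar>exp (- r) - exp (- t)\<bar> * exp t)"
    unfolding B_def by (intro sums_add sums_mult exp_term_sums)
  have le: "\<bar>poisson r n - poisson t n\<bar> \<le> B n" for n
  proof -
    have "poisson r n - poisson t n =
        exp (- r) * (exp_term r n - exp_term t n) + (exp (- r) - exp (- t)) * exp_term t n"
      by (simp add: poisson_def algebra_simps)
    also have "\<bar>\<dots>\<bar> \<le> \<bar>exp (- r) * (exp_term r n - exp_term t n)\<bar> + \<bar>(exp (- r) - exp (- t)) * exp_term t n\<bar>"
      by linarith
    also have "\<dots> = B n"
      using exp_term_nonneg[OF assms(1)] by (simp add: B_def abs_mult)
    finally show ?thesis .
  qed
  show summable: "summable (\<lambda>n. \<bar>poisson r n - poisson t n\<bar>)"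
    by (rule summable_comparison_test'[OF sums_summable[OF Bsums], of 0]) (simp add: le)
  show "(\<Sum>n. \<bar>poisson r n - poisson t n\<bar>) \<le>
      exp (- r) * \<bar>exp r - exp t\<bar> + \<bar>exp (- r) - exp (- t)\<bar> * exp t"
    unfolding sums_unique[OF Bsums] by (rule suminf_le[OF le summable sums_summable[OF Bsums]])
qed

section \<open>Norm estimates and absolutely convergent series in L^1\<close>

lemma L1_norm_nonneg: "0 \<le> L1_norm M f"
  by (simp add: L1_norm_def)

lemma L1_norm_cong_AE:
  assumes "f \<in> borel_measurable M" "h \<in> borel_measurable M" "AE x in M. f x = h x"
  shows "L1_norm M f = L1_norm M h"
  unfolding L1_norm_def by (rule integral_cong_AE) (use assms in auto)

lemma L1_norm_triangle:
  assumes "integrable M f" "integrable M h"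
  shows "L1_norm M (\<lambda>x. f x + h x) \<le> L1_norm M f + L1_norm M h"
proof -
  have "L1_norm M (\<lambda>x. f x + h x) \<le> (\<integral>x. \<bar>f x\<bar> + \<bar>h x\<bar> \<partial>M)"
    unfolding L1_norm_def using assms by (intro integral_mono) auto
  then show ?thesis
    unfolding L1_norm_def using assms by simp
qed

lemma L1_norm_minus: "L1_norm M (\<lambda>x. - f x) = L1_norm M f"
  by (simp add: L1_norm_def)

lemma L1_norm_triangle_diff:
  assumes "integrable M f" "integrable M h"
  shows "L1_norm M (\<lambda>x. f x - h x) \<le> L1_norm M f + L1_norm M h"
  using L1_norm_triangle[OF assms(1), of "\<lambda>x. - h x"] assms(2) by (simp add: L1_norm_minus)

lemma L1_norm_diff_ge:
  assumes "integrable M f" "integrable M h"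
  shows "\<bar>L1_norm M f - L1_norm M h\<bar> \<le> L1_norm M (\<lambda>x. f x - h x)"
proof -
  have "L1_norm M f \<le> L1_norm M (\<lambda>x. f x - h x) + L1_norm M h"
    using L1_norm_triangle[of M "\<lambda>x. f x - h x" h] assms by simp
  moreover have "L1_norm M h \<le> L1_norm M (\<lambda>x. f x - h x) + L1_norm M f"
    using L1_norm_triangle[of M "\<lambda>x. h x - f x" f] assms L1_norm_minus[of M "\<lambda>x. f x - h x"] by simp
  ultimately show ?thesis by linarith
qed

lemma L1_norm_eq_0_iff:
  assumes "integrable M f"
  shows "L1_norm M f = 0 \<longleftrightarrow> (AE x in M. f x = 0)"
  unfolding L1_norm_def using assms by (subst integral_nonneg_eq_0_iff_AE) auto

lemma abs_integral_le_L1_norm: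
  fixes f \<psi> :: "'a \<Rightarrow> real"
  assumes "integrable M f" "\<And>x. \<bar>\<psi> x\<bar> \<le> 1"
  shows "\<bar>\<integral>x. \<psi> x * f x \<partial>M\<bar> \<le> L1_norm M f"
proof -
  have "\<bar>\<integral>x. \<psi> x * f x \<partial>M\<bar> \<le> (\<integral>x. \<bar>\<psi> x * f x\<bar> \<partial>M)"
    by (rule integral_abs_bound)
  also have "\<dots> \<le> L1_norm M f"
    unfolding L1_norm_def
  proof (rule integral_mono_AE')
    show "AE x in M. \<bar>\<psi> x * f x\<bar> \<le> \<bar>f x\<bar>"
      using assms(2) by (auto simp: abs_mult intro!: mult_left_le_one_le)
  qed (use assms in auto)
  finally show ?thesis .
qed

lemma AE_summable_L1:
  fixes f :: "nat \<Rightarrow> 'a \<Rightarrow> real"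
  assumes int: "\<And>n. integrable M (f n)" and sum: "summable (\<lambda>n. L1_norm M (f n))"
  shows "AE x in M. summable (\<lambda>n. \<bar>f n x\<bar>)"
proof -
  have [measurable]: "f n \<in> borel_measurable M" for n
    using int by simp
  have "(\<integral>\<^sup>+x. (\<Sum>n. ennreal \<bar>f n x\<bar>) \<partial>M) = (\<Sum>n. \<integral>\<^sup>+x. ennreal \<bar>f n x\<bar> \<partial>M)"
    by (rule nn_integral_suminf) measurable
  also have "\<dots> = (\<Sum>n. ennreal (L1_norm M (f n)))"
    unfolding L1_norm_def by (intro arg_cong[where f = suminf] ext nn_integral_eq_integral) (use int in auto)
  also have "\<dots> \<noteq> \<infinity>"
    using ennreal_suminf_neq_top[OF sum L1_norm_nonneg] by simp
  finally have "AE x in M. (\<Sum>n. ennreal \<bar>f n x\<bar>) \<noteq> \<infinity>"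
    by (rule nn_integral_PInf_AE[rotated]) simp
  then show ?thesis
    by eventually_elim (rule summable_suminf_not_top, auto)
qed

lemma L1_series:
  fixes f :: "nat \<Rightarrow> 'a \<Rightarrow> real"
  assumes int: "\<And>n. integrable M (f n)" and sum: "summable (\<lambda>n. L1_norm M (f n))"
  shows integrable_L1_series: "integrable M (\<lambda>x. \<Sum>n. f n x)"
    and L1_norm_series_le: "L1_norm M (\<lambda>x. \<Sum>n. f n x) \<le> (\<Sum>n. L1_norm M (f n))"
proof -
  have ae: "AE x in M. summable (\<lambda>n. \<bar>f n x\<bar>)"
    by (rule AE_summable_L1[OF assms])
  show "integrable M (\<lambda>x. \<Sum>n. f n x)"
    by (rule integrable_suminf) (use int ae sum in \<open>auto simp: L1_norm_def\<close>)
  have "integrable M (\<lambda>x. \<Sum>n. \<bar>f n x\<bar>)"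
    by (rule integrable_suminf) (use int ae sum in \<open>auto simp: L1_norm_def\<close>)
  then have "L1_norm M (\<lambda>x. \<Sum>n. f n x) \<le> (\<integral>x. (\<Sum>n. \<bar>f n x\<bar>) \<partial>M)"
    unfolding L1_norm_def
  proof (rule integral_mono_AE')
    show "AE x in M. \<bar>\<Sum>n. f n x\<bar> \<le> (\<Sum>n. \<bar>f n x\<bar>)"
      using ae by eventually_elim (rule summable_rabs)
    show "AE x in M. 0 \<le> (\<Sum>n. \<bar>f n x\<bar>)"
      using ae by eventually_elim (simp add: suminf_nonneg)
  qed
  also have "\<dots> = (\<Sum>n. L1_norm M (f n))"
    unfolding L1_norm_def
    by (rule integral_suminf) (use int ae sum in \<open>auto simp: L1_norm_def\<close>)
  finally show "L1_norm M (\<lambda>x. \<Sum>n. f n x) \<le> (\<Sum>n. L1_norm M (f n))" .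
qed

text \<open>For a family bounded in L^1, questions about the series are reduced to the l^1 norm of
  its coefficients. The heat flow, its increments and its difference quotients are all of this form,
  over the same family.\<close>

lemma L1_bounded_series:
  fixes F :: "nat \<Rightarrow> 'a \<Rightarrow> real"
  assumes int: "\<And>n. integrable M (F n)" and bound: "\<And>n. L1_norm M (F n) \<le> m"
    and c: "summable (\<lambda>n. \<bar>c n\<bar>)"
  shows summable_L1_bounded_series: "summable (\<lambda>n. L1_norm M (\<lambda>x. c n * F n x))"
    and AE_summable_L1_bounded_series: "AE x in M. summable (\<lambda>n. \<bar>c n * F n x\<bar>)"
    and integrable_L1_bounded_series: "integrable M (\<lambda>x. \<Sum>n. c n * F n x)"
    and L1_norm_bounded_series_le: "L1_norm M (\<lambda>x. \<Sum>n. c n * F n x) \<le> m * (\<Sum>n. \<bar>c n\<bar>)"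
proof -
  have norm: "L1_norm M (\<lambda>x. c n * F n x) = \<bar>c n\<bar> * L1_norm M (F n)" for n
    by (simp add: L1_norm_def abs_mult)
  have le: "L1_norm M (\<lambda>x. c n * F n x) \<le> m * \<bar>c n\<bar>" for n
    unfolding norm using mult_left_mono[OF bound abs_ge_zero[of "c n"]] by (simp add: mult.commute)
  have sm: "summable (\<lambda>n. m * \<bar>c n\<bar>)"
    by (rule summable_mult[OF c])
  show s: "summable (\<lambda>n. L1_norm M (\<lambda>x. c n * F n x))"
    using le by (intro summable_comparison_test'[OF sm, of 0]) (auto simp: L1_norm_nonneg)
  have int': "integrable M (\<lambda>x. c n * F n x)" for n
    using int by simp
  show "AE x in M. summable (\<lambda>n. \<bar>c n * F n x\<bar>)"
    by (rule AE_summable_L1[OF int' s])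
  show "integrable M (\<lambda>x. \<Sum>n. c n * F n x)"
    by (rule integrable_L1_series[OF int' s])
  have "L1_norm M (\<lambda>x. \<Sum>n. c n * F n x) \<le> (\<Sum>n. L1_norm M (\<lambda>x. c n * F n x))"
    by (rule L1_norm_series_le[OF int' s])
  also have "\<dots> \<le> (\<Sum>n. m * \<bar>c n\<bar>)"
    by (rule suminf_le[OF le s sm])
  also have "\<dots> = m * (\<Sum>n. \<bar>c n\<bar>)"
    by (rule suminf_mult[OF c])
  finally show "L1_norm M (\<lambda>x. \<Sum>n. c n * F n x) \<le> m * (\<Sum>n. \<bar>c n\<bar>)" .
qed

text \<open>A substitute for Gronwall's inequality without differentiability. Zero is propagated by
  steps of length 1/4: at a maximum \<open>p\<close> of \<open>N\<close> on a step, the inequality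
  gives N(p) \<le> (1/4) 2 N(\<xi>) \<le> N(p) / 2.\<close>

lemma eq_0_if_mean_value_ineq:
  fixes N :: "real \<Rightarrow> real"
  assumes cont: "continuous_on {0..} N" and nonneg: "\<And>t. 0 \<le> N t" and N0: "N 0 = 0"
    and ineq: "\<And>s t. 0 \<le> s \<Longrightarrow> s < t \<Longrightarrow> \<exists>\<xi>. s < \<xi> \<and> \<xi> < t \<and> N t \<le> N s + (t - s) * (2 * N \<xi>)"
    and t: "0 \<le> t"
  shows "N t = 0"
proof -
  have "\<forall>t\<in>{0..real k / 4}. N t = 0" for k :: nat
  proof (induction k)
    case (Suc k)
    let ?I = "{real k / 4..real (Suc k) / 4}"
    have "continuous_on ?I N"
      using cont by (rule continuous_on_subset) auto
    then obtain p where p: "p \<in> ?I" "\<And>t. t \<in> ?I \<Longrightarrow> N t \<le> N p"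
      using continuous_attains_sup[of ?I N] by auto
    have k0: "N (real k / 4) = 0"
      using Suc by simp
    have "N p = 0"
    proof (cases "p = real k / 4")
      case True
      show ?thesis unfolding True by (rule k0)
    next
      case False
      then have "real k / 4 < p" using p by auto
      then obtain \<xi> where \<xi>: "real k / 4 < \<xi>" "\<xi> < p" "N p \<le> N (real k / 4) + (p - real k / 4) * (2 * N \<xi>)"
        using ineq[of "real k / 4" p] by auto
      have "p - real k / 4 \<le> 1 / 4"
        using p(1) by auto
      then have "(p - real k / 4) * (2 * N \<xi>) \<le> 1 / 4 * (2 * N \<xi>)"
        using nonneg[of \<xi>] by (intro mult_right_mono) auto
      moreover have "N \<xi> \<le> N p"
        using p \<xi> by auto
      ultimately show ?thesis
        using \<xi>(3) k0 nonneg[of p] by linarith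
    qed
    then have "N t = 0" if "t \<in> ?I" for t
      using p(2)[OF that] nonneg[of t] by simp
    with Suc show ?case
      by (metis atLeastAtMost_iff linorder_le_cases)
  qed (use N0 in simp)
  moreover obtain k :: nat where "4 * t \<le> real k"
    using real_arch_simple by blast
  ultimately show ?thesis
    using t by (auto simp: field_simps)
qed


section \<open>The heat flow of a bistochastic kernel\<close>

locale bistochastic_kernel = sigma_finite_measure M for M :: "'a measure" +
  fixes K :: "'a \<Rightarrow> 'a \<Rightarrow> real"
  assumes K_measurable [measurable]: "(\<lambda>p. K (fst p) (snd p)) \<in> borel_measurable (M \<Otimes>\<^sub>M M)"
    and K_nonneg: "0 \<le> K x y"
    and K_row: "(\<integral>y. K x y \<partial>M) = 1"
    and K_column: "(\<integral>x. K x y \<partial>M) = 1"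
begin

sublocale P: pair_sigma_finite M M ..

text \<open>A non-integrable function has integral 0 by convention, so the value 1 forces
  integrability.\<close>

lemma K_row_integrable: "integrable M (\<lambda>y. K x y)"
  using K_row[of x] not_integrable_integral_eq by fastforce

lemma K_column_integrable: "integrable M (\<lambda>x. K x y)"
  using K_column[of y] not_integrable_integral_eq by fastforce

text \<open>The value is the default 0 at those x where the integrand is not integrable. For an L^1
  function these x form a null set, hence the almost-everywhere form of the linearity
  statements.\<close>

definition kernel_op :: "('a \<Rightarrow> real) \<Rightarrow> 'a \<Rightarrow> real" where
  "kernel_op f x = (\<integral>y. K x y * f y \<partial>M)"

text \<open>Integrating first over the first variable of \<open>K\<close> leaves \<bar>f y\<bar>,
  because columns have mass 1; this is why the variables are swapped before Fubini's theorem is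
  applied.\<close>

lemma kernel_pair_integrable:
  assumes f: "integrable M f"
  shows "integrable (M \<Otimes>\<^sub>M M) (\<lambda>(x, y). K x y * f y)"
proof -
  have [measurable]: "f \<in> borel_measurable M"
    using f by simp
  have [measurable]: "(\<lambda>p. K (snd p) (fst p)) \<in> borel_measurable (M \<Otimes>\<^sub>M M)"
    using measurable_pair_swap[OF K_measurable] by (simp add: split_beta')
  have "integrable (M \<Otimes>\<^sub>M M) (\<lambda>p. K (snd p) (fst p) * f (fst p))"
  proof (rule P.Fubini_integrable)
    have "(\<integral>x. norm (K (snd (y, x)) (fst (y, x)) * f (fst (y, x))) \<partial>M) = \<bar>f y\<bar>" for y
      using K_column[of y] by (simp add: abs_mult K_nonneg)
    then show "integrable M (\<lambda>y. \<integral>x. norm (K (snd (y, x)) (fst (y, x)) * f (fst (y, x))) \<partial>M)"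
      using f by simp
  qed (auto intro: K_column_integrable)
  from P.integrable_product_swap[OF this] show ?thesis by simp
qed

lemma AE_kernel_integrable:
  "integrable M f \<Longrightarrow> AE x in M. integrable M (\<lambda>y. K x y * f y)"
  using P.AE_integrable_fst'[OF kernel_pair_integrable, of f] by simp

lemma kernel_op_integrable: "integrable M f \<Longrightarrow> integrable M (kernel_op f)"
  using P.integrable_fst'[OF kernel_pair_integrable, of f] by (simp add: kernel_op_def[abs_def])

lemma integral_kernel_op:
  assumes "integrable M f"
  shows "(\<integral>x. kernel_op f x \<partial>M) = (\<integral>x. f x \<partial>M)"
proof -
  have "(\<integral>x. kernel_op f x \<partial>M) = (\<integral>y. (\<integral>x. K x y * f y \<partial>M) \<partial>M)"
    unfolding kernel_op_def by (rule P.Fubini_integral[OF kernel_pair_integrable[OF assms], symmetric])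
  also have "\<dots> = (\<integral>y. f y \<partial>M)"
    using K_column by simp
  finally show ?thesis .
qed

text \<open>Valid at every x: where the integrand is not integrable, the left side is 0 and the
  right side is nonnegative.\<close>

lemma abs_kernel_op_le: "\<bar>kernel_op f x\<bar> \<le> kernel_op (\<lambda>y. \<bar>f y\<bar>) x"
proof -
  have "\<bar>kernel_op f x\<bar> \<le> (\<integral>y. \<bar>K x y * f y\<bar> \<partial>M)"
    unfolding kernel_op_def by (rule integral_abs_bound)
  then show ?thesis
    by (simp add: kernel_op_def abs_mult K_nonneg)
qed

lemma L1_norm_kernel_op_le:
  assumes "integrable M f"
  shows "L1_norm M (kernel_op f) \<le> L1_norm M f"
proof -
  have "L1_norm M (kernel_op f) \<le> (\<integral>x. kernel_op (\<lambda>y. \<bar>f y\<bar>) x \<partial>M)"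
    unfolding L1_norm_def using assms abs_kernel_op_le kernel_op_integrable by (intro integral_mono) auto
  then show ?thesis
    using integral_kernel_op[of "\<lambda>y. \<bar>f y\<bar>"] assms by (simp add: L1_norm_def)
qed

lemma AE_kernel_op_diff:
  assumes "integrable M f" "integrable M h"
  shows "AE x in M. kernel_op (\<lambda>y. f y - h y) x = kernel_op f x - kernel_op h x"
  using AE_kernel_integrable[OF assms(1)] AE_kernel_integrable[OF assms(2)]
  by eventually_elim (simp add: kernel_op_def right_diff_distrib)

text \<open>For fixed x the interchange of sum and integral needs the series of T\<bar>f n\<bar>(x)
  to converge. It does for almost every x, as T does not increase L^1 norms.\<close>

lemma AE_kernel_op_suminf:
  assumes int: "\<And>n. integrable M (f n)" and sum: "summable (\<lambda>n. L1_norm M (f n))"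
  shows "AE x in M. kernel_op (\<lambda>y. \<Sum>n. f n y) x = (\<Sum>n. kernel_op (f n) x)"
proof -
  have int_abs: "integrable M (\<lambda>y. \<bar>f n y\<bar>)" for n
    using int by simp
  have "L1_norm M (kernel_op (\<lambda>y. \<bar>f n y\<bar>)) \<le> L1_norm M (f n)" for n
    using L1_norm_kernel_op_le[OF int_abs] by (simp add: L1_norm_def)
  then have "summable (\<lambda>n. L1_norm M (kernel_op (\<lambda>y. \<bar>f n y\<bar>)))"
    by (intro summable_comparison_test'[OF sum, of 0]) (simp add: L1_norm_nonneg)
  then have "AE x in M. summable (\<lambda>n. \<bar>kernel_op (\<lambda>y. \<bar>f n y\<bar>) x\<bar>)"
    by (intro AE_summable_L1 kernel_op_integrable int_abs)
  moreover have "AE x in M. \<forall>n. integrable M (\<lambda>y. K x y * f n y)"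
    unfolding AE_all_countable using AE_kernel_integrable int by blast
  ultimately show ?thesis
  proof eventually_elim
    case (elim x)
    have norm: "norm (K x y * f n y) = K x y * \<bar>f n y\<bar>" for n y
      by (simp add: abs_mult K_nonneg)
    have "(\<integral>y. (\<Sum>n. K x y * f n y) \<partial>M) = (\<Sum>n. \<integral>y. K x y * f n y \<partial>M)"
    proof (rule integral_suminf)
      show "AE y in M. summable (\<lambda>n. norm (K x y * f n y))"
        unfolding norm using AE_summable_L1[OF int sum] by eventually_elim (rule summable_mult)
      show "summable (\<lambda>n. \<integral>y. norm (K x y * f n y) \<partial>M)"
        unfolding norm using summable_rabs_cancel[OF elim(1)] by (simp add: kernel_op_def)
    qed (use elim in simp)
    moreover have "(\<integral>y. K x y * (\<Sum>n. f n y) \<partial>M) = (\<integral>y. (\<Sum>n. K x y * f n y) \<partial>M)"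
    proof (rule integral_cong_AE)
      have [measurable]: "f n \<in> borel_measurable M" for n
        using int by simp
      have [measurable]: "(\<lambda>y. K x y) \<in> borel_measurable M"
        using K_row_integrable by simp
      show "(\<lambda>y. K x y * (\<Sum>n. f n y)) \<in> borel_measurable M" "(\<lambda>y. \<Sum>n. K x y * f n y) \<in> borel_measurable M"
        by measurable
      show "AE y in M. K x y * (\<Sum>n. f n y) = (\<Sum>n. K x y * f n y)"
        using AE_summable_L1[OF int sum]
        by eventually_elim (rule suminf_mult[OF summable_rabs_cancel, symmetric])
    qed
    ultimately show ?case
      by (simp add: kernel_op_def)
  qed
qed

lemma abs_kernel_op_le_bound:
  assumes "f \<in> borel_measurable M" "AE y in M. \<bar>f y\<bar> \<le> B"
  shows "\<bar>kernel_op f x\<bar> \<le> B"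
proof -
  have [measurable]: "f \<in> borel_measurable M" "(\<lambda>y. K x y) \<in> borel_measurable M"
    using assms(1) K_row_integrable by auto
  have "AE y in M. K x y * \<bar>f y\<bar> \<le> K x y * B"
    using assms(2) by eventually_elim (simp add: mult_left_mono K_nonneg)
  \<comment> \<open>The sign of \<open>B\<close> is read off from the pointwise bound, almost
    everywhere.\<close>
  moreover have "AE y in M. 0 \<le> K x y * B"
    using assms(2) by eventually_elim (intro mult_nonneg_nonneg K_nonneg, simp)
  ultimately have "kernel_op (\<lambda>y. \<bar>f y\<bar>) x \<le> (\<integral>y. K x y * B \<partial>M)"
    unfolding kernel_op_def using K_row_integrable by (intro integral_mono_AE') auto
  also have "\<dots> = B"
    using K_row by simp
  finally show ?thesis
    using abs_kernel_op_le[of f x] by linarith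
qed

section \<open>Iterates of the kernel operator and the flow they generate\<close>

definition kernel_pow :: "('a \<Rightarrow> real) \<Rightarrow> nat \<Rightarrow> 'a \<Rightarrow> real" where
  "kernel_pow u0 n = (kernel_op ^^ n) u0"

lemma kernel_pow_0: "kernel_pow u0 0 = u0"
  and kernel_op_kernel_pow: "kernel_op (kernel_pow u0 n) = kernel_pow u0 (Suc n)"
  by (simp_all add: kernel_pow_def)

lemma kernel_pow_integrable: "integrable M u0 \<Longrightarrow> integrable M (kernel_pow u0 n)"
  by (induction n) (auto simp: kernel_pow_0 kernel_op_kernel_pow[symmetric] intro: kernel_op_integrable)

lemma L1_norm_kernel_pow_le:
  assumes "integrable M u0"
  shows "L1_norm M (kernel_pow u0 n) \<le> L1_norm M u0"
proof (induction n)
  case (Suc n)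
  have "L1_norm M (kernel_pow u0 (Suc n)) \<le> L1_norm M (kernel_pow u0 n)"
    unfolding kernel_op_kernel_pow[symmetric]
    by (rule L1_norm_kernel_op_le[OF kernel_pow_integrable[OF assms]])
  with Suc show ?case by linarith
qed (simp add: kernel_pow_0)

lemma AE_abs_kernel_pow_le:
  assumes "integrable M u0" "AE y in M. \<bar>u0 y\<bar> \<le> B"
  shows "AE x in M. \<bar>kernel_pow u0 n x\<bar> \<le> B"
proof (induction n)
  case (Suc n)
  have "\<bar>kernel_pow u0 (Suc n) x\<bar> \<le> B" for x
    unfolding kernel_op_kernel_pow[symmetric]
    using abs_kernel_op_le_bound Suc kernel_pow_integrable[OF assms(1)] borel_measurable_integrable by blast
  then show ?case by simp
qed (use assms(2) in \<open>simp add: kernel_pow_0\<close>)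

text \<open>The series is summed pointwise. The null set on which it may diverge depends on
  \<open>t\<close>, so identities relating different times hold almost everywhere.\<close>

definition heat_flow :: "('a \<Rightarrow> real) \<Rightarrow> real \<Rightarrow> 'a \<Rightarrow> real" where
  "heat_flow u0 t x = (\<Sum>n. poisson t n * kernel_pow u0 n x)"

lemma poisson_summable: "0 \<le> t \<Longrightarrow> summable (\<lambda>n. \<bar>poisson t n\<bar>)"
  using poisson_sums[of t] by (simp add: poisson_nonneg sums_iff)

lemma poisson_suminf: "0 \<le> t \<Longrightarrow> (\<Sum>n. \<bar>poisson t n\<bar>) = 1"
  using poisson_sums[of t] by (simp add: poisson_nonneg sums_iff)

context
  fixes u0 :: "'a \<Rightarrow> real"
  assumes u0: "integrable M u0"
begin

lemmas kernel_pow_series = kernel_pow_integrable[OF u0] L1_norm_kernel_pow_le[OF u0]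

lemma AE_kernel_pow_series_summable:
  assumes "summable (\<lambda>n. \<bar>c n\<bar>)"
  shows "AE x in M. summable (\<lambda>n. c n * kernel_pow u0 n x)"
  using AE_summable_L1_bounded_series[where F = "kernel_pow u0", OF kernel_pow_series assms]
  by eventually_elim (rule summable_rabs_cancel)

lemma heat_flow_integrable: "0 \<le> t \<Longrightarrow> integrable M (heat_flow u0 t)"
  unfolding heat_flow_def[abs_def]
  by (rule integrable_L1_bounded_series[OF kernel_pow_series poisson_summable])

lemma L1_norm_heat_flow_le: "0 \<le> t \<Longrightarrow> L1_norm M (heat_flow u0 t) \<le> L1_norm M u0"
  using L1_norm_bounded_series_le[OF kernel_pow_series poisson_summable, of t]
  by (simp add: heat_flow_def[abs_def] poisson_suminf)

lemma heat_flow_0: "heat_flow u0 0 x = u0 x"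
proof -
  have "poisson 0 n = (if n = 0 then 1 else 0)" for n
    by (simp add: poisson_def exp_term_def power_0_left)
  then have "heat_flow u0 0 x = (\<Sum>n. if n = 0 then kernel_pow u0 n x else 0)"
    unfolding heat_flow_def by (intro suminf_cong) auto
  then show ?thesis
    using sums_single[of 0 "\<lambda>n. kernel_pow u0 n x"] by (simp add: kernel_pow_0 sums_iff)
qed

lemma AE_abs_heat_flow_le:
  assumes "0 \<le> t" "AE y in M. \<bar>u0 y\<bar> \<le> B"
  shows "AE x in M. \<bar>heat_flow u0 t x\<bar> \<le> B"
proof -
  have "AE x in M. \<forall>n. \<bar>kernel_pow u0 n x\<bar> \<le> B"
    unfolding AE_all_countable using AE_abs_kernel_pow_le[OF u0 assms(2)] by blast
  then show ?thesis
  proof eventually_elim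
    case (elim x)
    have "norm (\<Sum>n. poisson t n * kernel_pow u0 n x) \<le> (\<Sum>n. poisson t n * B)"
      using elim poisson_nonneg[OF assms(1)] sums_mult2[OF poisson_sums[of t], of B]
      by (intro norm_suminf_le) (auto simp: abs_mult sums_iff intro!: mult_left_mono)
    also have "\<dots> = B"
      using sums_mult2[OF poisson_sums[of t], of B] by (simp add: sums_iff)
    finally show ?case
      by (simp add: heat_flow_def)
  qed
qed

lemma heat_flow_continuous: "continuous_L1 M (heat_flow u0)"
  unfolding continuous_L1_def
proof (intro conjI allI impI)
  fix t :: real assume t: "0 \<le> t"
  show "integrable M (heat_flow u0 t)"
    by (rule heat_flow_integrable[OF t])
  let ?m = "L1_norm M u0"
  let ?D = "\<lambda>r. exp (- r) * \<bar>exp r - exp t\<bar> + \<bar>exp (- r) - exp (- t)\<bar> * exp t"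
  have "L1_norm M (\<lambda>x. heat_flow u0 r x - heat_flow u0 t x) \<le> ?m * ?D r" if r: "0 \<le> r" for r
  proof -
    note S = sum_poisson_difference[OF t r]
    let ?S = "\<lambda>x. \<Sum>n. (poisson r n - poisson t n) * kernel_pow u0 n x"
    have "AE x in M. heat_flow u0 r x - heat_flow u0 t x = ?S x"
      using AE_kernel_pow_series_summable[OF poisson_summable[OF r]]
        AE_kernel_pow_series_summable[OF poisson_summable[OF t]]
      by eventually_elim (simp add: heat_flow_def suminf_diff left_diff_distrib)
    then have "L1_norm M (\<lambda>x. heat_flow u0 r x - heat_flow u0 t x) = L1_norm M ?S"
      using heat_flow_integrable[OF r] heat_flow_integrable[OF t]
        integrable_L1_bounded_series[OF kernel_pow_series S(1)]
      by (intro L1_norm_cong_AE) auto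
    also have "\<dots> \<le> ?m * (\<Sum>n. \<bar>poisson r n - poisson t n\<bar>)"
      by (rule L1_norm_bounded_series_le[OF kernel_pow_series S(1)])
    also have "\<dots> \<le> ?m * ?D r"
      by (rule mult_left_mono[OF S(2) L1_norm_nonneg])
    finally show ?thesis .
  qed
  then have "\<forall>\<^sub>F r in at t within {0..}. norm (L1_norm M (\<lambda>x. heat_flow u0 r x - heat_flow u0 t x)) \<le> ?m * ?D r"
    by (auto simp: eventually_at_filter L1_norm_nonneg)
  moreover have "((\<lambda>r. ?m * ?D r) \<longlongrightarrow> ?m * ?D t) (at t within {0..})"
    by (intro tendsto_intros)
  then have "((\<lambda>r. ?m * ?D r) \<longlongrightarrow> 0) (at t within {0..})"
    by simp
  ultimately show "((\<lambda>r. L1_norm M (\<lambda>x. heat_flow u0 r x - heat_flow u0 t x)) \<longlongrightarrow> 0) (at t within {0..})"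
    by (rule Lim_null_comparison)
qed

text \<open>T raises the index of \<open>kernel_pow\<close> by one, so T u(t) has the weight at n -
  1 as its n-th coefficient. Subtracting u(t) gives exactly \<open>poisson_deriv\<close>.
  Summability is part of the conclusion because the series is later combined term by term with the
  difference quotient.\<close>

lemma AE_heat_flow_generator:
  assumes t: "0 \<le> t"
  shows "AE x in M. summable (\<lambda>n. poisson_deriv t n * kernel_pow u0 n x) \<and>
    kernel_op (heat_flow u0 t) x - heat_flow u0 t x = (\<Sum>n. poisson_deriv t n * kernel_pow u0 n x)"
proof -
  let ?F = "kernel_pow u0"
  let ?a = "poisson t"
  have shift: "kernel_op (\<lambda>y. ?a n * ?F n y) x = ?a n * ?F (Suc n) x" for n x
    unfolding kernel_op_kernel_pow[symmetric] by (simp add: kernel_op_def mult.left_commute[of _ "?a n"])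
  have "AE x in M. kernel_op (heat_flow u0 t) x = (\<Sum>n. ?a n * ?F (Suc n) x)"
    unfolding heat_flow_def[abs_def] shift[symmetric]
    by (rule AE_kernel_op_suminf)
      (use kernel_pow_series summable_L1_bounded_series[OF kernel_pow_series poisson_summable[OF t]] in auto)
  moreover have "AE x in M. summable (\<lambda>n. ?a n * ?F n x)"
    by (rule AE_kernel_pow_series_summable[OF poisson_summable[OF t]])
  \<comment> \<open>The shifted weights, with 0 in front, so that both series run over the same
    iterates.\<close>
  moreover have "AE x in M. summable (\<lambda>n. (case n of 0 \<Rightarrow> 0 | Suc k \<Rightarrow> ?a k) * ?F n x)"
  proof (rule AE_kernel_pow_series_summable)
    have "summable (\<lambda>n. \<bar>case Suc n of 0 \<Rightarrow> 0 | Suc k \<Rightarrow> ?a k\<bar>)"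
      using poisson_summable[OF t] by simp
    then show "summable (\<lambda>n. \<bar>case n of 0 \<Rightarrow> 0 | Suc k \<Rightarrow> ?a k\<bar>)"
      by (subst (asm) summable_Suc_iff)
  qed
  ultimately show ?thesis
  proof eventually_elim
    case (elim x)
    let ?s = "\<lambda>n. (case n of 0 \<Rightarrow> 0 | Suc k \<Rightarrow> ?a k) * ?F n x"
    have deriv: "poisson_deriv t n * ?F n x = ?s n - ?a n * ?F n x" for n
      by (simp add: poisson_deriv_def poisson_def exp_term_deriv_def algebra_simps split: nat.split)
    have "(\<Sum>n. ?a n * ?F (Suc n) x) = (\<Sum>n. ?s n)"
      using suminf_split_head[OF elim(3)] by simp
    then show ?case
      unfolding deriv using elim
      by (simp add: suminf_diff[symmetric] summable_diff heat_flow_def)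
  qed
qed

lemma heat_flow_has_L1_derivative:
  assumes t: "0 < t"
  shows "has_L1_derivative M (heat_flow u0) (\<lambda>x. kernel_op (heat_flow u0 t) x - heat_flow u0 t x) t"
proof -
  let ?m = "L1_norm M u0"
  let ?v = "\<lambda>x. kernel_op (heat_flow u0 t) x - heat_flow u0 t x"
  let ?D = "\<lambda>h. exp (- (t + h)) * \<bar>(exp (t + h) - exp t) / h - exp t\<bar> +
      \<bar>exp (- (t + h)) - exp (- t)\<bar> * exp t + \<bar>(exp (- (t + h)) - exp (- t)) / h + exp (- t)\<bar> * exp t"
  have t0: "0 \<le> t" using t by simp
  have int_v: "integrable M ?v"
    using heat_flow_integrable[OF t0] kernel_op_integrable by simp
  \<comment> \<open>Only nonnegative times are controlled. As \<open>t\<close> is positive, the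
    restriction on \<open>h\<close> holds for all \<open>h\<close> close to 0.\<close>
  have le: "L1_norm M (\<lambda>x. (heat_flow u0 (t + h) x - heat_flow u0 t x) / h - ?v x) \<le> ?m * ?D h"
    if h: "0 \<le> t + h" "h \<noteq> 0" for h
  proof -
    note S = sum_poisson_difference_quotient[OF t0 h]
    let ?S = "\<lambda>x. \<Sum>n. ((poisson (t + h) n - poisson t n) / h - poisson_deriv t n) * kernel_pow u0 n x"
    have "AE x in M. (heat_flow u0 (t + h) x - heat_flow u0 t x) / h - ?v x = ?S x"
      using AE_kernel_pow_series_summable[OF poisson_summable[OF h(1)]]
        AE_kernel_pow_series_summable[OF poisson_summable[OF t0]] AE_heat_flow_generator[OF t0]
    proof eventually_elim
      case (elim x)
      have "(\<lambda>n. (poisson (t + h) n * kernel_pow u0 n x - poisson t n * kernel_pow u0 n x) / h -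
          poisson_deriv t n * kernel_pow u0 n x) sums
          ((heat_flow u0 (t + h) x - heat_flow u0 t x) / h - ?v x)"
        using elim unfolding heat_flow_def by (intro sums_diff sums_divide) (auto simp: summable_sums)
      then show ?case
        by (simp add: sums_iff left_diff_distrib)
    qed
    then have "L1_norm M (\<lambda>x. (heat_flow u0 (t + h) x - heat_flow u0 t x) / h - ?v x) = L1_norm M ?S"
      using heat_flow_integrable[OF h(1)] heat_flow_integrable[OF t0] int_v
        integrable_L1_bounded_series[OF kernel_pow_series S(1)]
      by (intro L1_norm_cong_AE) auto
    also have "\<dots> \<le> ?m * (\<Sum>n. \<bar>(poisson (t + h) n - poisson t n) / h - poisson_deriv t n\<bar>)"
      by (rule L1_norm_bounded_series_le[OF kernel_pow_series S(1)])
    also have "\<dots> \<le> ?m * ?D h"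
      by (rule mult_left_mono[OF S(2) L1_norm_nonneg])
    finally show ?thesis .
  qed
  have "\<forall>\<^sub>F h in at 0. 0 \<le> t + h \<and> h \<noteq> 0"
    unfolding eventually_at using t by (intro exI[of _ t]) (auto simp: dist_real_def)
  then have "\<forall>\<^sub>F h in at 0. norm (L1_norm M (\<lambda>x. (heat_flow u0 (t + h) x - heat_flow u0 t x) / h - ?v x)) \<le> ?m * ?D h"
    by eventually_elim (use le in \<open>simp add: L1_norm_nonneg\<close>)
  moreover have "((\<lambda>h. ?m * ?D h) \<longlongrightarrow> 0) (at 0)"
    by (rule tendsto_mult_right_zero[OF sum_poisson_difference_quotient_tendsto])
  ultimately have "((\<lambda>h. L1_norm M (\<lambda>x. (heat_flow u0 (t + h) x - heat_flow u0 t x) / h - ?v x)) \<longlongrightarrow> 0) (at 0)"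
    by (rule Lim_null_comparison)
  with int_v show ?thesis
    unfolding has_L1_derivative_def by (rule conjI)
qed

end

end


section \<open>Uniqueness\<close>

lemma integrable_mult_bounded:
  fixes f \<psi> :: "'a \<Rightarrow> real"
  assumes "integrable M f" "\<psi> \<in> borel_measurable M" "\<And>x. \<bar>\<psi> x\<bar> \<le> 1"
  shows "integrable M (\<lambda>x. \<psi> x * f x)"
proof (rule Bochner_Integration.integrable_bound[OF assms(1)])
  show "AE x in M. norm (\<psi> x * f x) \<le> norm (f x)"
    using assms(3) by (auto simp: abs_mult intro!: mult_left_le_one_le)
qed (use assms in simp)

text \<open>Pairing with a test function bounded by 1 does not increase the L^1 norm, so it passes
  from L^1-valued functions to real ones, to which the scalar mean value theorem applies.\<close>

lemma continuous_L1_weak: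
  fixes \<psi> :: "'a \<Rightarrow> real"
  assumes u: "continuous_L1 M u" and \<psi>: "\<psi> \<in> borel_measurable M" "\<And>x. \<bar>\<psi> x\<bar> \<le> 1"
  shows "continuous_on {0..} (\<lambda>t. \<integral>x. \<psi> x * u t x \<partial>M)"
  unfolding continuous_on_def
proof
  fix t :: real assume "t \<in> {0..}"
  then have t: "0 \<le> t" by simp
  let ?F = "\<lambda>t. \<integral>x. \<psi> x * u t x \<partial>M"
  have int: "integrable M (u r)" if "0 \<le> r" for r
    using u that unfolding continuous_L1_def by blast
  have le: "norm (?F r - ?F t) \<le> L1_norm M (\<lambda>x. u r x - u t x)" if r: "0 \<le> r" for r
  proof -
    have "?F r - ?F t = (\<integral>x. \<psi> x * (u r x - u t x) \<partial>M)"
      using integrable_mult_bounded[OF int[OF r] \<psi>] integrable_mult_bounded[OF int[OF t] \<psi>]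
      by (simp add: right_diff_distrib)
    then show ?thesis
      using abs_integral_le_L1_norm[of M "\<lambda>x. u r x - u t x" \<psi>] int[OF r] int[OF t] \<psi>(2) by simp
  qed
  have "\<forall>\<^sub>F r in at t within {0..}. norm (?F r - ?F t) \<le> L1_norm M (\<lambda>x. u r x - u t x)"
    unfolding eventually_at_filter by (rule always_eventually) (simp add: le del: real_norm_def)
  moreover have "((\<lambda>r. L1_norm M (\<lambda>x. u r x - u t x)) \<longlongrightarrow> 0) (at t within {0..})"
    using u t unfolding continuous_L1_def by blast
  ultimately have "((\<lambda>r. ?F r - ?F t) \<longlongrightarrow> 0) (at t within {0..})"
    by (rule Lim_null_comparison)
  then show "(?F \<longlongrightarrow> ?F t) (at t within {0..})"
    by (rule LIM_zero_cancel)
qed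

lemma has_L1_derivative_weak:
  fixes \<psi> :: "'a \<Rightarrow> real"
  assumes int: "\<And>r. 0 \<le> r \<Longrightarrow> integrable M (u r)" and u: "has_L1_derivative M u v t" and t: "0 < t"
    and \<psi>: "\<psi> \<in> borel_measurable M" "\<And>x. \<bar>\<psi> x\<bar> \<le> 1"
  shows "((\<lambda>r. \<integral>x. \<psi> x * u r x \<partial>M) has_real_derivative (\<integral>x. \<psi> x * v x \<partial>M)) (at t)"
proof -
  let ?F = "\<lambda>t. \<integral>x. \<psi> x * u t x \<partial>M"
  let ?D = "\<integral>x. \<psi> x * v x \<partial>M"
  have v: "integrable M v"
    using u by (simp add: has_L1_derivative_def)
  have t0: "0 \<le> t" using t by simp
  have le: "norm ((?F (t + h) - ?F t) / h - ?D) \<le> L1_norm M (\<lambda>x. (u (t + h) x - u t x) / h - v x)"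
    if h: "0 \<le> t + h" for h
  proof -
    have "(?F (t + h) - ?F t) / h - ?D = (\<integral>x. (\<psi> x * u (t + h) x - \<psi> x * u t x) / h - \<psi> x * v x \<partial>M)"
      using integrable_mult_bounded[OF int[OF h] \<psi>] integrable_mult_bounded[OF int[OF t0] \<psi>]
        integrable_mult_bounded[OF v \<psi>] by simp
    also have "\<dots> = (\<integral>x. \<psi> x * ((u (t + h) x - u t x) / h - v x) \<partial>M)"
      by (simp add: right_diff_distrib)
    finally show ?thesis
      using abs_integral_le_L1_norm[of M "\<lambda>x. (u (t + h) x - u t x) / h - v x" \<psi>]
        int[OF h] int[OF t0] v \<psi>(2) by simp
  qed
  have "\<forall>\<^sub>F h in at 0. 0 \<le> t + h"
    unfolding eventually_at using t by (intro exI[of _ t]) (auto simp: dist_real_def)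
  then have "\<forall>\<^sub>F h in at 0. norm ((?F (t + h) - ?F t) / h - ?D) \<le> L1_norm M (\<lambda>x. (u (t + h) x - u t x) / h - v x)"
    by eventually_elim (rule le)
  moreover have "((\<lambda>h. L1_norm M (\<lambda>x. (u (t + h) x - u t x) / h - v x)) \<longlongrightarrow> 0) (at 0)"
    using u by (simp add: has_L1_derivative_def)
  ultimately have "((\<lambda>h. (?F (t + h) - ?F t) / h - ?D) \<longlongrightarrow> 0) (at 0)"
    by (rule Lim_null_comparison)
  then show ?thesis
    unfolding DERIV_def by (rule LIM_zero_cancel)
qed

context bistochastic_kernel
begin

text \<open>The constant is 1 + 1: one contribution from the contraction T, one from the
  identity.\<close>

lemma L1_norm_generator_le:
  assumes "integrable M f" "integrable M h"
  shows "L1_norm M (\<lambda>x. (kernel_op f x - f x) - (kernel_op h x - h x)) \<le> 2 * L1_norm M (\<lambda>x. f x - h x)"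
proof -
  let ?d = "\<lambda>x. f x - h x"
  have d: "integrable M ?d"
    using assms by simp
  note int = assms d kernel_op_integrable[OF assms(1)] kernel_op_integrable[OF assms(2)] kernel_op_integrable[OF d]
  have "AE x in M. (kernel_op f x - f x) - (kernel_op h x - h x) = kernel_op ?d x - ?d x"
    using AE_kernel_op_diff[OF assms] by eventually_elim simp
  then have "L1_norm M (\<lambda>x. (kernel_op f x - f x) - (kernel_op h x - h x)) = L1_norm M (\<lambda>x. kernel_op ?d x - ?d x)"
    using int by (intro L1_norm_cong_AE) auto
  also have "\<dots> \<le> L1_norm M (kernel_op ?d) + L1_norm M ?d"
    by (rule L1_norm_triangle_diff[OF kernel_op_integrable[OF d] d])
  also have "\<dots> \<le> 2 * L1_norm M ?d"
    using L1_norm_kernel_op_le[OF d] by simp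
  finally show ?thesis .
qed

text \<open>The increment of \<open>N\<close> is estimated through a differentiable function that
  lies below \<open>N\<close> and touches it at the later time; its derivative at an intermediate
  time is bounded by the norm of the generator there.\<close>

lemma L1_evolution_unique:
  assumes u: "continuous_L1 M u" "\<And>t. 0 < t \<Longrightarrow> has_L1_derivative M u (\<lambda>x. kernel_op (u t) x - u t x) t"
    and v: "continuous_L1 M v" "\<And>t. 0 < t \<Longrightarrow> has_L1_derivative M v (\<lambda>x. kernel_op (v t) x - v t x) t"
    and init: "AE x in M. u 0 x = v 0 x" and t: "0 \<le> t"
  shows "AE x in M. u t x = v t x"
proof -
  define N where "N t = L1_norm M (\<lambda>x. u t x - v t x)" for t
  have intu: "integrable M (u r)" and intv: "integrable M (v r)" if "0 \<le> r" for r
    using u(1) v(1) that unfolding continuous_L1_def by blast+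
  have "N t = 0"
  proof (rule eq_0_if_mean_value_ineq[OF _ _ _ _ t])
    show "continuous_on {0..} N"
      unfolding continuous_on_def
    proof
      fix t :: real assume "t \<in> {0..}"
      then have t: "0 \<le> t" by simp
      let ?B = "\<lambda>r. L1_norm M (\<lambda>x. u r x - u t x) + L1_norm M (\<lambda>x. v r x - v t x)"
      have le: "norm (N r - N t) \<le> ?B r" if r: "0 \<le> r" for r
      proof -
        note int = intu[OF r] intv[OF r] intu[OF t] intv[OF t]
        have "\<bar>N r - N t\<bar> \<le> L1_norm M (\<lambda>x. (u r x - v r x) - (u t x - v t x))"
          unfolding N_def using int by (intro L1_norm_diff_ge) auto
        also have "\<dots> = L1_norm M (\<lambda>x. (u r x - u t x) - (v r x - v t x))"
          by (simp add: algebra_simps)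
        also have "\<dots> \<le> ?B r"
          using int by (intro L1_norm_triangle_diff) auto
        finally show ?thesis by simp
      qed
      have "\<forall>\<^sub>F r in at t within {0..}. norm (N r - N t) \<le> ?B r"
        unfolding eventually_at_filter by (rule always_eventually) (simp add: le del: real_norm_def)
      moreover have "((\<lambda>r. ?B r) \<longlongrightarrow> 0) (at t within {0..})"
        using u(1) v(1) t unfolding continuous_L1_def by (intro tendsto_add_zero) blast+
      ultimately have "((\<lambda>r. N r - N t) \<longlongrightarrow> 0) (at t within {0..})"
        by (rule Lim_null_comparison)
      then show "(N \<longlongrightarrow> N t) (at t within {0..})"
        by (rule LIM_zero_cancel)
    qed
    show "0 \<le> N t" for t
      by (simp add: N_def L1_norm_nonneg)
    have "AE x in M. u 0 x - v 0 x = 0"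
      using init by eventually_elim simp
    then show "N 0 = 0"
      unfolding N_def using intu[of 0] intv[of 0] by (subst L1_norm_eq_0_iff) auto
  next
    \<comment> \<open>Pairing with the sign of the difference at time \<open>t\<close> reduces the estimate to the scalar mean
      value theorem.\<close>
    fix s t :: real assume s: "0 \<le> s" and st: "s < t"
    have t: "0 \<le> t" using s st by simp
    define \<psi> where "\<psi> x = (if v t x \<le> u t x then 1 else - 1 :: real)" for x
    have [measurable]: "u t \<in> borel_measurable M" "v t \<in> borel_measurable M"
      using intu[OF t] intv[OF t] by auto
    have "\<psi> \<in> borel_measurable M"
      unfolding \<psi>_def by measurable
    moreover have "\<bar>\<psi> x\<bar> \<le> 1" for x
      by (simp add: \<psi>_def)
    ultimately have \<psi>: "\<psi> \<in> borel_measurable M" "\<bar>\<psi> x\<bar> \<le> 1" for x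
      by auto
    define F where "F r = (\<integral>x. \<psi> x * u r x \<partial>M) - (\<integral>x. \<psi> x * v r x \<partial>M)" for r
    have F: "F r = (\<integral>x. \<psi> x * (u r x - v r x) \<partial>M)" if "0 \<le> r" for r
      unfolding F_def using integrable_mult_bounded[OF intu[OF that] \<psi>] integrable_mult_bounded[OF intv[OF that] \<psi>]
      by (simp add: right_diff_distrib)
    have "continuous_on {0..} F"
      unfolding F_def by (intro continuous_intros continuous_L1_weak u v \<psi>)
    then have cont: "continuous_on {s..t} F"
      by (rule continuous_on_subset) (use s in auto)
    let ?G = "\<lambda>w r x. kernel_op (w r) x - w r x"
    let ?D = "\<lambda>r. (\<integral>x. \<psi> x * ?G u r x \<partial>M) - (\<integral>x. \<psi> x * ?G v r x \<partial>M)"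
    have deriv: "(F has_real_derivative ?D r) (at r)" if "0 < r" for r
      unfolding F_def
      by (intro DERIV_diff has_L1_derivative_weak u(2) v(2) intu intv \<psi> that)
    \<comment> \<open>For \<open>s = 0\<close> there is no derivative at the left end. The mean
      value theorem asks for it in the open interval only.\<close>
    have "F differentiable (at r)" if "s < r" "r < t" for r
      using deriv[of r] s that by (auto simp: real_differentiable_def)
    then obtain l \<xi> where \<xi>: "s < \<xi>" "\<xi> < t" "DERIV F \<xi> :> l" "F t - F s = (t - s) * l"
      using MVT[OF st cont] by blast
    have \<xi>0: "0 < \<xi>" using \<xi>(1) s by simp
    have \<xi>0': "0 \<le> \<xi>" using \<xi>0 by simp
    have intG: "integrable M (?G u \<xi>)" "integrable M (?G v \<xi>)"
      using intu[OF \<xi>0'] intv[OF \<xi>0'] kernel_op_integrable by auto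
    have "l = ?D \<xi>"
      using DERIV_unique[OF \<xi>(3) deriv[OF \<xi>0]] .
    also have "\<dots> = (\<integral>x. \<psi> x * (?G u \<xi> x - ?G v \<xi> x) \<partial>M)"
      using integrable_mult_bounded[OF intG(1) \<psi>] integrable_mult_bounded[OF intG(2) \<psi>]
      by (subst Bochner_Integration.integral_diff[symmetric]) (simp_all add: right_diff_distrib)
    also have "\<dots> \<le> L1_norm M (\<lambda>x. ?G u \<xi> x - ?G v \<xi> x)"
      using abs_integral_le_L1_norm[of M "\<lambda>x. ?G u \<xi> x - ?G v \<xi> x" \<psi>] intG \<psi>(2) by simp
    also have "\<dots> \<le> 2 * N \<xi>"
      unfolding N_def by (rule L1_norm_generator_le[OF intu[OF \<xi>0'] intv[OF \<xi>0']])
    finally have "(t - s) * l \<le> (t - s) * (2 * N \<xi>)"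
      using st by (intro mult_left_mono) auto
    \<comment> \<open>At the time at which \<open>\<psi>\<close> was chosen, its product with the
      difference is the absolute value; at \<open>s\<close> only an inequality remains.\<close>
    moreover have "F t = N t"
      unfolding F[OF t] N_def L1_norm_def \<psi>_def by (intro Bochner_Integration.integral_cong) auto
    moreover have "F s \<le> N s"
      unfolding F[OF s] N_def
      using abs_integral_le_L1_norm[of M "\<lambda>x. u s x - v s x" \<psi>] intu[OF s] intv[OF s] \<psi>(2) by simp
    ultimately have "N t \<le> N s + (t - s) * (2 * N \<xi>)"
      using \<xi>(4) by linarith
    with \<xi> show "\<exists>\<xi>>s. \<xi> < t \<and> N t \<le> N s + (t - s) * (2 * N \<xi>)"
      by blast
  qed
  then have "AE x in M. u t x - v t x = 0"
    unfolding N_def using intu[OF t] intv[OF t] by (subst (asm) L1_norm_eq_0_iff) auto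
  then show ?thesis
    by eventually_elim simp
qed

end


section \<open>The geodesic kernel on the manifold and the Cauchy problem\<close>

theorem theorem2p1:
  fixes \<A> :: "('a::{t2_space,second_countable_topology}, 'e::euclidean_space) chart set"
    and g :: "('a, 'e) metric_tensor"
    and base :: 'a
    and \<tau> :: "'a \<Rightarrow> 'a \<Rightarrow> 'a"
    and \<mu> :: "'a measure"
    and J :: "real \<Rightarrow> real"
    and u0 :: "'a \<Rightarrow> real"
  assumes manifold: "riemannian_manifold \<A> g"
    and isometries: "\<And>x. isometry \<A> g (\<tau> x)"
    and to_base: "\<And>x. \<tau> x x = base"
    and borel_measure: "sets \<mu> = sets borel"
    and sigma_finite: "sigma_finite_measure \<mu>"
    and invariant: "\<And>x. distr \<mu> \<mu> (\<tau> x) = \<mu>"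
    and J_measurable: "J \<in> borel_measurable (restrict_space borel {0..})"
    and J_nonneg: "\<And>r. 0 \<le> r \<Longrightarrow> 0 \<le> J r"
    and J_normalized: "(\<integral>x. J (geodesic_dist \<A> g x base) \<partial>\<mu>) = 1"
    and u0_L1: "integrable \<mu> u0"
  shows "(\<exists>u. cauchy_solution \<mu> (geodesic_dist \<A> g) J u0 u \<and>
            (\<forall>v. cauchy_solution \<mu> (geodesic_dist \<A> g) J u0 v \<longrightarrow>
               (\<forall>t\<ge>0. AE x in \<mu>. v t x = u t x)) \<and>
            (\<forall>t\<ge>0. L1_norm \<mu> (u t) \<le> L1_norm \<mu> u0) \<and>
            (in_Linf \<mu> u0 \<longrightarrow> (\<forall>t\<ge>0. Linf_norm \<mu> (u t) \<le> Linf_norm \<mu> u0)))"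
proof -
  interpret riemannian \<A> g
    by unfold_locales (rule manifold)
  let ?d = "geodesic_dist \<A> g"
  let ?K = "\<lambda>x y. J (?d x y)"
  have space: "space \<mu> = UNIV"
    using sets_eq_imp_space_eq[OF borel_measure] by simp
  have pair: "sets (\<mu> \<Otimes>\<^sub>M \<mu>) = sets (borel \<Otimes>\<^sub>M borel)"
    using borel_measure by (intro sets_pair_measure_cong)
  \<comment> \<open>\<open>J\<close> is measurable only on the nonnegative reals, so the distance is
    regarded as a map into that subspace.\<close>
  have "(\<lambda>p. ?d (fst p) (snd p)) \<in> borel \<Otimes>\<^sub>M borel \<rightarrow>\<^sub>M restrict_space borel {0..}"
    using borel_measurable_geodesic_dist by (intro measurable_restrict_space2) (auto simp: geodesic_dist_nonneg)
  then have "(\<lambda>p. ?K (fst p) (snd p)) \<in> borel_measurable (borel \<Otimes>\<^sub>M borel)"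
    using J_measurable by (rule measurable_compose)
  then have K_meas: "(\<lambda>p. ?K (fst p) (snd p)) \<in> borel_measurable (\<mu> \<Otimes>\<^sub>M \<mu>)"
    by (simp add: measurable_cong_sets[OF pair refl])
  have K_base: "(\<lambda>x. ?K x base) \<in> borel_measurable \<mu>"
    using measurable_compose[OF measurable_Pair2'[of base \<mu> \<mu>] K_meas] space by simp
  have row: "(\<integral>y. ?K x y \<partial>\<mu>) = 1" for x
  proof -
    have "continuous_on UNIV (\<tau> x)"
      using isometries[of x] by (simp add: isometry_def smooth_map_def)
    then have "\<tau> x \<in> borel_measurable borel"
      by (rule borel_measurable_continuous_onI)
    then have \<tau>: "\<tau> x \<in> \<mu> \<rightarrow>\<^sub>M \<mu>"
      by (simp add: measurable_cong_sets[OF borel_measure borel_measure])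
    \<comment> \<open>Since \<open>\<tau> x\<close> maps \<open>x\<close> to \<open>base\<close>,
      the row at \<open>x\<close> is the profile around \<open>base\<close> composed with
      \<open>\<tau> x\<close>, and invariance of the measure then removes \<open>\<tau> x\<close>
      from the integral.\<close>
    have "?d x y = ?d (\<tau> x y) base" for y
      using geodesic_dist_isometry[OF isometries[of x], of x y] geodesic_dist_commute[of base]
      by (simp add: to_base)
    then have "(\<integral>y. ?K x y \<partial>\<mu>) = (\<integral>y. ?K (\<tau> x y) base \<partial>\<mu>)"
      by (simp only:)
    also have "\<dots> = (\<integral>z. ?K z base \<partial>distr \<mu> \<mu> (\<tau> x))"
      by (rule integral_distr[OF \<tau> K_base, symmetric])
    finally show ?thesis
      using invariant[of x] J_normalized by simp
  qed
  interpret bistochastic_kernel \<mu> ?K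
  proof (intro bistochastic_kernel.intro sigma_finite bistochastic_kernel_axioms.intro K_meas row)
    show "0 \<le> ?K x y" for x y
      by (rule J_nonneg[OF geodesic_dist_nonneg])
    show "(\<integral>x. ?K x y \<partial>\<mu>) = 1" for y
      using row[of y] by (simp add: geodesic_dist_commute[of _ y])
  qed
  have op: "nonlocal_op \<mu> ?d J u = (\<lambda>x. kernel_op u x - u x)" for u
    by (simp add: nonlocal_op_def kernel_op_def fun_eq_iff)
  have sol: "cauchy_solution \<mu> ?d J u0 (heat_flow u0)"
    unfolding cauchy_solution_def op
    using heat_flow_continuous[OF u0_L1] heat_flow_has_L1_derivative[OF u0_L1] heat_flow_0[OF u0_L1] by simp
  have unique: "AE x in \<mu>. v t x = heat_flow u0 t x" if v: "cauchy_solution \<mu> ?d J u0 v" and t: "0 \<le> t" for v t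
  proof -
    have "AE x in \<mu>. v 0 x = u0 x"
      using v by (simp add: cauchy_solution_def)
    then have init: "AE x in \<mu>. v 0 x = heat_flow u0 0 x"
      by (simp add: heat_flow_0[OF u0_L1])
    show ?thesis
      by (rule L1_evolution_unique[where u = v and v = "heat_flow u0"])
        (use v sol init t in \<open>simp_all add: cauchy_solution_def op\<close>)
  qed
  have Linf: "Linf_norm \<mu> (heat_flow u0 t) \<le> Linf_norm \<mu> u0" if u0: "in_Linf \<mu> u0" and t: "0 \<le> t" for t
  proof -
    obtain B where B: "Linf_norm \<mu> u0 = ennreal B" "0 \<le> B"
      using u0 by (cases "Linf_norm \<mu> u0") (auto simp: in_Linf_def)
    have "AE x in \<mu>. ennreal \<bar>u0 x\<bar> \<le> ennreal B"
      using esssup_AE[of "\<lambda>x. ennreal \<bar>u0 x\<bar>" \<mu>] B(1) by (simp add: Linf_norm_def)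
    then have "AE x in \<mu>. \<bar>u0 x\<bar> \<le> B"
      using B(2) by simp
    from AE_abs_heat_flow_le[OF u0_L1 t this]
    have "AE x in \<mu>. ennreal \<bar>heat_flow u0 t x\<bar> \<le> ennreal B"
      by eventually_elim (rule ennreal_leI)
    then show ?thesis
      \<comment> \<open>The norm of \<open>u0\<close> is replaced by the number \<open>B\<close>
        before the definition is unfolded, so that only the essential supremum of the flow
        remains.\<close>
      unfolding B(1) unfolding Linf_norm_def
      using heat_flow_integrable[OF u0_L1 t] by (intro esssup_I) auto
  qed
  show ?thesis
    using sol unique L1_norm_heat_flow_le[OF u0_L1] Linf by (intro exI[of _ "heat_flow u0"]) blast
qed

end
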